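(* Let $k\ge 3$, fix $0<c<1$, and let $d=d(n)=o(n)$. Then \[ \left\lvert\frac{\log \lvert\mathcal{G}_{d,c,k}(n)\rvert}{(d/2)n \log n} - \left(1 - c \cdot \frac{d-1}{d+1}\right)\right\rvert = O\left(\frac{\log d}{\log n}\right). \] Furthermore, if $d$ is fixed, then for every fixed $\varepsilon>0$, the proportion of elements of $\mathcal{G}_{d,c,k}(n)$ with more than $\varepsilon n$ bad nodes tends to $0$ as $n\to\infty$.
   Context: $\mathcal{G}_{d,c,k}(n)$ is the set of $d$-regular graphs on $n$ labeled nodes containing at least $c\binom{d}{k-1}\frac{n}{k}$ subgraphs isomorphic to the complete graph $K_k$ (note $\binom{d}{k-1}\frac nk$ is the maximum possible number). A node is bad if it is contained in some copy of $K_k$ but is not contained in any clique on $d+1$ nodes.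
   Formalization: The asymptotic formula is stated for d(n) ≥ k−1 for all large n (for smaller d the clique condition is vacuous and the formula fails, e.g. k=4, d=2) and only for n with n·d(n) even, since otherwise there are no d-regular graphs on n nodes and the logarithm is undefined. *)

theory Defs
  imports Complex_Main
begin

definition simple_graph :: "nat \<Rightarrow> nat set set \<Rightarrow> bool" where
  "simple_graph n E \<longleftrightarrow> (\<forall>e\<in>E. e \<subseteq> {..<n} \<and> card e = 2)"

definition degree :: "nat set set \<Rightarrow> nat \<Rightarrow> nat" where
  "degree E v = card {u. {u, v} \<in> E}"

definition regular_graph :: "nat \<Rightarrow> nat \<Rightarrow> nat set set \<Rightarrow> bool" where
  "regular_graph n d E \<longleftrightarrow> simple_graph n E \<and> (\<forall>v<n. degree E v = d)"

definition is_clique :: "nat set set \<Rightarrow> nat set \<Rightarrow> bool" where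
  "is_clique E S \<longleftrightarrow> (\<forall>u\<in>S. \<forall>v\<in>S. u \<noteq> v \<longrightarrow> {u, v} \<in> E)"

text \<open>Copies of K_k in the graph: a complete subgraph is determined by its node set.\<close>
definition cliques :: "nat \<Rightarrow> nat \<Rightarrow> nat set set \<Rightarrow> nat set set" where
  "cliques n k E = {S. S \<subseteq> {..<n} \<and> card S = k \<and> is_clique E S}"

definition Gdck :: "nat \<Rightarrow> real \<Rightarrow> nat \<Rightarrow> nat \<Rightarrow> nat set set set" where
  "Gdck d c k n = {E. regular_graph n d E \<and>
      real (card (cliques n k E)) \<ge> c * real (d choose (k - 1)) * real n / real k}"

definition bad_nodes :: "nat \<Rightarrow> nat \<Rightarrow> nat \<Rightarrow> nat set set \<Rightarrow> nat set" where
  "bad_nodes n d k E = {v. v < n \<and> (\<exists>S\<in>cliques n k E. v \<in> S)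
                              \<and> \<not> (\<exists>S\<in>cliques n (d + 1) E. v \<in> S)}"

end

theory Submission
  imports Defs "HOL-Combinatorics.Permutations"
begin

text \<open>Upper bound: process the vertices in some order and pay for an edge only if no common
  neighbour of its ends comes before both of them. The unpaid edges are recovered from the paid ones
  at a cost of \<open>O(log d)\<close> bits each, because such an edge closes a triangle whose two other edges are
  recovered earlier. In a uniformly random order an edge in \<open>t\<close> triangles is paid with probability
  \<open>2 / (t + 2) \<le> 1 - t / (d + 1)\<close>, and the number of copies of \<open>K\<^sub>k\<close> bounds the sum of the \<open>t\<close> from
  below. A bad node is incident with an edge where the last inequality is strict, which saves a
  constant fraction of the cost if there are linearly many of them.

  Lower bound: about \<open>c n / (d + 1)\<close> disjoint copies of \<open>K\<^sub>d\<^sub>+\<^sub>1\<close> and arbitrary lifts of \<open>K\<^sub>d\<^sub>,\<^sub>d\<close> on the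
  remaining vertices; this needs \<open>d\<close> to be at most a small power of \<open>n\<close>, and for larger \<open>d\<close> the error
  term \<open>O(log d / log n)\<close> is of constant order.\<close>

section \<open>Orders and paid edges\<close>

definition nbrs :: "nat set set \<Rightarrow> nat \<Rightarrow> nat set" where
  "nbrs E v = {u. {u, v} \<in> E}"

definition common :: "nat set set \<Rightarrow> nat set \<Rightarrow> nat set" where
  "common E e = {w. \<forall>x\<in>e. {w, x} \<in> E}"

text \<open>\<open>p v\<close> is read as the position of \<open>v\<close> in the order;
  \<open>card (common E e)\<close> is the number of triangles through an edge
  \<open>e\<close>.\<close>

definition paid :: "(nat \<Rightarrow> nat) \<Rightarrow> nat set set \<Rightarrow> nat set set" where
  "paid p E = {e \<in> E. \<forall>w\<in>common E e. \<exists>x\<in>e. p x < p w}"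

lemma degree_eq_card_nbrs: "degree E v = card (nbrs E v)"
  by (simp add: degree_def nbrs_def)

lemma nbrs_commute: "u \<in> nbrs E v \<longleftrightarrow> v \<in> nbrs E u"
  by (simp add: nbrs_def insert_commute)

lemma simple_graph_finite:
  assumes "simple_graph n E" shows "finite E"
proof -
  have "E \<subseteq> Pow {..<n}" using assms by (auto simp: simple_graph_def)
  then show ?thesis by (rule finite_subset) simp
qed

lemma simple_graph_edgeD:
  assumes "simple_graph n E" "{u, v} \<in> E"
  shows "u < n" "v < n" "u \<noteq> v"
proof -
  have "{u, v} \<subseteq> {..<n}" "card {u, v} = 2" using assms by (auto simp: simple_graph_def)
  then show "u < n" "v < n" "u \<noteq> v" by (auto simp: card_insert_if split: if_splits)
qed

lemma simple_graph_edgeE: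
  assumes "simple_graph n E" "e \<in> E"
  obtains u v where "e = {u, v}" "u \<noteq> v" "u < n" "v < n"
proof -
  have "e \<subseteq> {..<n}" "card e = 2" using assms by (auto simp: simple_graph_def)
  then obtain u v where "e = {u, v}" "u \<noteq> v" by (auto simp: card_2_iff)
  then show thesis using that \<open>e \<subseteq> {..<n}\<close> by simp
qed

lemma nbrs_subset: "simple_graph n E \<Longrightarrow> nbrs E v \<subseteq> {..<n} - {v}"
proof
  fix u assume "simple_graph n E" "u \<in> nbrs E v"
  then show "u \<in> {..<n} - {v}" using simple_graph_edgeD[of n E u v] by (simp add: nbrs_def)
qed

lemma finite_nbrs: "simple_graph n E \<Longrightarrow> finite (nbrs E v)"
  by (rule finite_subset[OF nbrs_subset]) auto

lemma common_pair: "common E {u, v} = nbrs E u \<inter> nbrs E v"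
  by (auto simp: common_def nbrs_def)

text \<open>Precomposing with the transposition of \<open>x\<close> and \<open>y\<close> exchanges
  the events that \<open>x\<close> resp. \<open>y\<close> comes first in \<open>S\<close>, so these
  events are equally large; by injectivity they partition the permutations of
  \<open>U\<close>.\<close>

lemma card_permutations_min:
  fixes U :: "'a::linorder set"
  assumes "finite U" "S \<subseteq> U" "x \<in> S"
  shows "card S * card {p. p permutes U \<and> (\<forall>y\<in>S. p x \<le> p y)} = fact (card U)"
proof -
  define P where "P y = {p. p permutes U \<and> (\<forall>z\<in>S. p y \<le> p z)}" for y
  have finS: "finite S" using assms finite_subset by blast
  have finP: "finite (P y)" for y
    unfolding P_def using finite_permutations[OF assms(1)] by (rule rev_finite_subset) auto
  have step: "card (P x) \<le> card (P y)" if "x \<in> S" "y \<in> S" for x y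
  proof (rule card_inj_on_le[where f = "\<lambda>p. p \<circ> transpose x y"])
    show "inj_on (\<lambda>p. p \<circ> transpose x y) (P x)"
    proof (rule inj_onI)
      fix p q :: "'a \<Rightarrow> 'a" assume "p \<circ> transpose x y = q \<circ> transpose x y"
      then have "p \<circ> transpose x y \<circ> transpose x y = q \<circ> transpose x y \<circ> transpose x y" by simp
      then show "p = q" by (simp add: comp_assoc)
    qed
    show "(\<lambda>p. p \<circ> transpose x y) ` P x \<subseteq> P y"
    proof clarify
      fix p assume p: "p \<in> P x"
      have "p \<circ> transpose x y permutes U"
        using p that assms(2) by (auto simp: P_def intro!: permutes_compose permutes_swap_id)
      moreover have "transpose x y z \<in> S" if "z \<in> S" for z
        using that \<open>x \<in> S\<close> \<open>y \<in> S\<close> by (auto simp: transpose_def)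
      ultimately show "p \<circ> transpose x y \<in> P y" using p by (auto simp: P_def)
    qed
    show "finite (P y)" by (rule finP)
  qed
  have cover: "{p. p permutes U} = (\<Union>y\<in>S. P y)"
  proof (intro equalityI subsetI)
    fix p assume p: "p \<in> {p. p permutes U}"
    have "Min (p ` S) \<in> p ` S" using finS assms(3) by (intro Min_in) auto
    then obtain y where "y \<in> S" "p y = Min (p ` S)" by auto
    moreover have "Min (p ` S) \<le> p z" if "z \<in> S" for z using that finS by simp
    ultimately have "p \<in> P y" using p \<open>p y = _\<close> by (simp add: P_def)
    then show "p \<in> (\<Union>y\<in>S. P y)" using \<open>y \<in> S\<close> by blast
  qed (auto simp: P_def)
  have "fact (card U) = card {p. p permutes U}"
    using card_permutations[OF refl assms(1)] by simp
  also have "\<dots> = (\<Sum>y\<in>S. card (P y))"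
    unfolding cover
  proof (rule card_UN_disjoint[OF finS])
    show "\<forall>y\<in>S. finite (P y)" using finP by blast
    show "\<forall>y\<in>S. \<forall>z\<in>S. y \<noteq> z \<longrightarrow> P y \<inter> P z = {}"
    proof (intro ballI impI)
      fix y z assume yz: "y \<in> S" "z \<in> S" "y \<noteq> z"
      show "P y \<inter> P z = {}"
      proof (rule ccontr)
        assume "P y \<inter> P z \<noteq> {}"
        then obtain p where "p \<in> P y" "p \<in> P z" by blast
        then have p: "p permutes U" "p y = p z"
          using yz by (simp_all add: P_def antisym)
        then show False using permutes_inj[OF p(1)] yz(3) by (meson injD)
      qed
    qed
  qed
  also have "\<dots> = (\<Sum>y\<in>S. card (P x))"
    using step assms(3) by (intro sum.cong refl antisym) auto
  finally show ?thesis by (simp add: P_def)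
qed

text \<open>The edge can be paid only if the first vertex of \<open>S\<close>, the ends together
  with their common neighbours, is one of the ends. Each of the \<open>card S = t + 2\<close>
  vertices is first in the same share of the orders.\<close>

lemma card_paid_permutations_le:
  assumes "simple_graph n E" "e \<in> E"
  shows "real (card {p. p permutes {..<n} \<and> e \<in> paid p E}) \<le> fact n * (2 / (real (card (common E e)) + 2))"
proof -
  obtain u v where e: "e = {u, v}" "u \<noteq> v" "u < n" "v < n"
    using simple_graph_edgeE[OF assms] by blast
  define S where "S = {u, v} \<union> common E e"
  define P where "P y = {p. p permutes {..<n} \<and> (\<forall>z\<in>S. p y \<le> p z)}" for y
  have com: "common E e \<subseteq> {..<n} - {u, v}"
    using nbrs_subset[OF assms(1)] unfolding e common_pair by blast
  have fin: "finite (common E e)" using com finite_subset by blast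
  have cS: "card S = card (common E e) + 2"
    using com fin e unfolding S_def by (subst card_Un_disjoint) auto
  have SU: "S \<subseteq> {..<n}" using com e by (auto simp: S_def)
  have cP: "real (card (P y)) = fact n / (real (card (common E e)) + 2)" if "y \<in> S" for y
  proof -
    have "card S * card (P y) = fact n"
      using card_permutations_min[OF _ SU that] by (simp add: P_def)
    then have "real (card S) * real (card (P y)) = fact n" by (metis of_nat_fact of_nat_mult)
    then show ?thesis by (simp add: cS field_simps)
  qed
  have finP: "finite (P y)" for y
    unfolding P_def using finite_permutations[of "{..<n}"] by (rule rev_finite_subset) auto
  have "{p. p permutes {..<n} \<and> e \<in> paid p E} \<subseteq> P u \<union> P v"
  proof clarify
    fix p assume p: "p permutes {..<n}" "e \<in> paid p E" "p \<notin> P v"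
    have *: "p u < p w \<or> p v < p w" if "w \<in> common E e" for w
      using p(2) that unfolding paid_def e by auto
    show "p \<in> P u"
    proof -
      from p(1,3) obtain z where z: "z \<in> S" "p z < p v" by (auto simp: P_def)
      \<comment> \<open>If \<open>z\<close> is not \<open>u\<close>, it is a common neighbour
        preceding \<open>v\<close>; as the edge is paid, \<open>u\<close> must precede
        \<open>z\<close>.\<close>
      have uv: "p u < p v"
        using z * unfolding S_def e(1) by force
      then have "p u \<le> p w" if "w \<in> S" for w
        using that * unfolding S_def e(1) by force
      then show ?thesis using p(1) by (simp add: P_def)
    qed
  qed
  then have "card {p. p permutes {..<n} \<and> e \<in> paid p E} \<le> card (P u) + card (P v)"
    using finP by (meson card_Un_le card_mono finite_UnI order_trans)
  then have "real (card {p. p permutes {..<n} \<and> e \<in> paid p E}) \<le> real (card (P u)) + real (card (P v))"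
    by linarith
  also have "\<dots> = fact n * (2 / (real (card (common E e)) + 2))"
    using cP[of u] cP[of v] by (simp add: S_def)
  finally show ?thesis .
qed

text \<open>First-moment argument: the right-hand side bounds the mean number of paid edges over all
  permutations, and some permutation does no worse than the mean.\<close>

lemma exists_cheap_order:
  assumes "simple_graph n E"
  obtains p where "p permutes {..<n}"
    "real (card (paid p E)) \<le> (\<Sum>e\<in>E. 2 / (real (card (common E e)) + 2))"
proof -
  let ?B = "\<Sum>e\<in>E. 2 / (real (card (common E e)) + 2)"
  let ?P = "{p. p permutes {..<n}}"
  have "\<exists>p. p permutes {..<n} \<and> real (card (paid p E)) \<le> ?B"
  proof (rule ccontr)
    assume "\<not> ?thesis"
    then have more: "?B < real (card (paid p E))" if "p permutes {..<n}" for p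
      using that by (simp only: not_ex de_Morgan_conj not_le) blast
    have finP: "finite ?P" by (simp add: finite_permutations)
    have finE: "finite E" using simple_graph_finite[OF assms] .
    have "id \<in> ?P" by simp
    have "fact n * ?B = (\<Sum>p\<in>?P. ?B)"
      using card_permutations[of "{..<n}" n] by simp
    also have "\<dots> < (\<Sum>p\<in>?P. real (card (paid p E)))"
      using \<open>id \<in> ?P\<close> more by (intro sum_strict_mono finP) (blast, simp only: mem_Collect_eq)
    also have "\<dots> = (\<Sum>p\<in>?P. \<Sum>e\<in>E. if e \<in> paid p E then 1 else 0)"
    proof (rule sum.cong[OF refl])
      fix p
      have "paid p E = E \<inter> {e. e \<in> paid p E}" by (auto simp: paid_def)
      then show "real (card (paid p E)) = (\<Sum>e\<in>E. if e \<in> paid p E then 1 else 0)"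
        using finE by (simp add: sum.If_cases)
    qed
    also have "\<dots> = (\<Sum>e\<in>E. \<Sum>p\<in>?P. if e \<in> paid p E then 1 else 0)"
      by (rule sum.swap)
    also have "\<dots> = (\<Sum>e\<in>E. real (card {p. p permutes {..<n} \<and> e \<in> paid p E}))"
      using finP by (intro sum.cong refl) (simp add: sum.If_cases Collect_conj_eq)
    also have "\<dots> \<le> (\<Sum>e\<in>E. fact n * (2 / (real (card (common E e)) + 2)))"
      by (intro sum_mono card_paid_permutations_le assms)
    also have "\<dots> = fact n * ?B" by (simp add: sum_distrib_left)
    finally show False by simp
  qed
  then show thesis using that by blast
qed

section \<open>Encoding regular graphs\<close>

text \<open>Addressing a neighbour by its rank in the sorted neighbourhood takes \<open>ln d\<close>
  instead of \<open>ln n\<close>; this is what makes unpaid edges cheap.\<close>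

definition nbr :: "nat set set \<Rightarrow> nat \<Rightarrow> nat \<Rightarrow> nat" where
  "nbr E v i = sorted_list_of_set (nbrs E v) ! i"

text \<open>\<open>I (v, i) = (b, j, l)\<close> tells how to find the \<open>i\<close>-th neighbour
  of \<open>v\<close>. A true flag \<open>b\<close> points into the paid graph \<open>F\<close>;
  otherwise the neighbour is reached in two hops inside \<open>E\<close> through a vertex earlier
  than both ends. The order \<open>p\<close> only certifies that the recursion ends and is not part
  of the code.\<close>

definition decodes :: "nat \<Rightarrow> nat \<Rightarrow> (nat \<Rightarrow> nat) \<Rightarrow> nat set set \<Rightarrow> nat set set
    \<Rightarrow> (nat \<times> nat \<Rightarrow> bool \<times> nat \<times> nat) \<Rightarrow> bool" where
  "decodes n d p E F I \<longleftrightarrow> (\<forall>v<n. \<forall>i<d. case I (v, i) of (b, j, l) \<Rightarrow> j < d \<and> l < d \<and>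
     (if b then nbr E v i = nbr F v j
      else nbr E v i = nbr E (nbr E v j) l \<and> p (nbr E v j) < p v \<and> p (nbr E v j) < p (nbr E v i)))"

lemma nbr_in: "finite (nbrs E v) \<Longrightarrow> i < card (nbrs E v) \<Longrightarrow> nbr E v i \<in> nbrs E v"
  unfolding nbr_def by (metis nth_mem set_sorted_list_of_set sorted_list_of_set.length_sorted_key_list_of_set)

lemma nbr_surj:
  assumes "finite (nbrs E v)" "u \<in> nbrs E v"
  obtains i where "i < card (nbrs E v)" "nbr E v i = u"
  using assms unfolding nbr_def
  by (metis in_set_conv_nth set_sorted_list_of_set sorted_list_of_set.length_sorted_key_list_of_set)

lemma regular_graphD:
  assumes "regular_graph n d E"
  shows "simple_graph n E" "v < n \<Longrightarrow> card (nbrs E v) = d" "finite (nbrs E v)"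
  using assms finite_nbrs by (auto simp: regular_graph_def degree_eq_card_nbrs)

lemma regular_nbr:
  assumes "regular_graph n d E" "v < n" "i < d"
  shows "nbr E v i \<in> nbrs E v" "nbr E v i < n"
proof -
  show "nbr E v i \<in> nbrs E v" using nbr_in[OF regular_graphD(3)[OF assms(1)]] regular_graphD(2)[OF assms(1)] assms by simp
  then show "nbr E v i < n" using nbrs_subset[OF regular_graphD(1)[OF assms(1)]] by blast
qed

lemma regular_nbr_surj:
  assumes "regular_graph n d E" "v < n" "u \<in> nbrs E v"
  obtains i where "i < d" "nbr E v i = u"
  using nbr_surj[OF regular_graphD(3)[OF assms(1)] assms(3)] regular_graphD(2)[OF assms(1,2)] by metis

lemma regular_graph_eq_nbr:
  assumes "regular_graph n d E"
  shows "E = {{nbr E v i, v} | v i. v < n \<and> i < d}"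
proof (intro equalityI subsetI)
  fix e assume e: "e \<in> E"
  then obtain u v where uv: "e = {u, v}" "v < n"
    using simple_graph_edgeE[OF regular_graphD(1)[OF assms]] by metis
  then have "u \<in> nbrs E v" using e by (simp add: nbrs_def)
  then obtain i where "i < d" "nbr E v i = u" using regular_nbr_surj[OF assms uv(2)] by blast
  then show "e \<in> {{nbr E v i, v} | v i. v < n \<and> i < d}" using uv by blast
next
  fix e assume "e \<in> {{nbr E v i, v} | v i. v < n \<and> i < d}"
  then show "e \<in> E" using regular_nbr(1)[OF assms] by (auto simp: nbrs_def)
qed

text \<open>The recursion of the decoder is well-founded along the order of one graph only, so the two
  graphs may have been encoded with different orders.\<close>

lemma decodes_unique:
  assumes E: "regular_graph n d E" "decodes n d p E F I"
    and E': "regular_graph n d E'" "decodes n d p' E' F I"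
  shows "E = E'"
proof -
  have "nbr E v i = nbr E' v i" if "v < n" "i < d" for v i
    using that
  \<comment> \<open>The measure is the earlier position of the two ends. In the unpaid case both
    hops, from \<open>v\<close> to \<open>w\<close> and from \<open>w\<close> to the target, have
    measure \<open>p w\<close>, below that of the edge itself.\<close>
  proof (induction "min (p v) (p (nbr E v i))" arbitrary: v i rule: less_induct)
    case less
    obtain b j l where I: "I (v, i) = (b, j, l)" by (cases "I (v, i)")
    have c: "j < d" "l < d"
      "if b then nbr E v i = nbr F v j
       else nbr E v i = nbr E (nbr E v j) l \<and> p (nbr E v j) < p v \<and> p (nbr E v j) < p (nbr E v i)"
      using E(2) less.prems I unfolding decodes_def by fastforce+
    have c': "if b then nbr E' v i = nbr F v j else nbr E' v i = nbr E' (nbr E' v j) l"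
      using E'(2) less.prems I unfolding decodes_def by fastforce
    show ?case
    proof (cases b)
      case True
      then show ?thesis using c c' by simp
    next
      case False
      define w where "w = nbr E v j"
      have w: "nbr E v i = nbr E w l" "p w < p v" "p w < p (nbr E v i)"
        using c(3) False unfolding w_def by argo+
      have "w < n" using regular_nbr(2)[OF E(1) less.prems(1) c(1)] by (simp add: w_def)
      have "w = nbr E' v j"
        using less.hyps[OF _ less.prems(1) c(1)] w by (simp add: w_def)
      moreover have "nbr E w l = nbr E' w l"
        using less.hyps[OF _ \<open>w < n\<close> c(2)] w by simp
      ultimately show ?thesis using c' False w by simp
    qed
  qed
  then have "{{nbr E v i, v} | v i. v < n \<and> i < d} = {{nbr E' v i, v} | v i. v < n \<and> i < d}"
    by metis
  then show ?thesis using regular_graph_eq_nbr[OF E(1)] regular_graph_eq_nbr[OF E'(1)] by simp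
qed

text \<open>An unpaid edge has, by definition of \<open>paid\<close>, a common neighbour no later
  than either end; ranks along this detour form the index. Paid edges are looked up in the paid
  graph, whose neighbourhoods have at most \<open>d\<close> elements.\<close>

lemma exists_code:
  assumes E: "regular_graph n d E" and p: "p permutes {..<n}"
  shows "\<exists>I\<in>({..<n} \<times> {..<d}) \<rightarrow>\<^sub>E (UNIV \<times> {..<d} \<times> {..<d}). decodes n d p E (paid p E) I"
proof -
  note sg = regular_graphD(1)[OF E]
  let ?F = "paid p E"
  let ?ok = "\<lambda>(v, i) (b, j, l). j < d \<and> l < d \<and> (if b then nbr E v i = nbr ?F v j
      else nbr E v i = nbr E (nbr E v j) l \<and> p (nbr E v j) < p v \<and> p (nbr E v j) < p (nbr E v i))"
  have sub: "nbrs ?F v \<subseteq> nbrs E v" for v by (auto simp: nbrs_def paid_def)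
  have ex: "\<exists>y\<in>UNIV \<times> {..<d} \<times> {..<d}. ?ok x y" if "x \<in> {..<n} \<times> {..<d}" for x
  proof -
    obtain v i where x: "x = (v, i)" "v < n" "i < d" using \<open>x \<in> _\<close> by (cases x) auto
    define u where "u = nbr E v i"
    have u: "u \<in> nbrs E v" "u < n" using regular_nbr[OF E x(2,3)] by (simp_all add: u_def)
    show ?thesis
    proof (cases "{u, v} \<in> ?F")
      case True
      have fin: "finite (nbrs ?F v)" using sub regular_graphD(3)[OF E] finite_subset by blast
      have "u \<in> nbrs ?F v" using True by (simp add: nbrs_def)
      then obtain j where j: "j < card (nbrs ?F v)" "nbr ?F v j = u" using nbr_surj[OF fin] by metis
      have "j < d"
        using j(1) card_mono[OF regular_graphD(3)[OF E] sub, of v] regular_graphD(2)[OF E x(2)] by simp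
      \<comment> \<open>The last component is a dummy here; \<open>0 < d\<close> holds because
        \<open>i < d\<close>.\<close>
      then have "?ok x (True, j, 0)" using j(2) x by (simp add: u_def)
      then show ?thesis using \<open>j < d\<close> x(3) by (intro bexI[of _ "(True, j, 0)"]) auto
    next
      case False
      have "{u, v} \<in> E" using u by (simp add: nbrs_def)
      then obtain w where w: "w \<in> common E {u, v}" "p w \<le> p u" "p w \<le> p v"
        using False unfolding paid_def by (auto simp: not_less)
      have wn: "w \<in> nbrs E u" "w \<in> nbrs E v" using w(1) by (auto simp: common_pair)
      then have "w \<noteq> u" "w \<noteq> v" "w < n" using nbrs_subset[OF sg] by blast+
      \<comment> \<open>Strict because \<open>w\<close> differs from both ends and \<open>p\<close>
        is injective; strictness makes the decoder's recursion descend.\<close>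
      then have lt: "p w < p u" "p w < p v"
        using w(2,3) permutes_inj[OF p] by (metis injD le_neq_implies_less)+
      obtain j where j: "j < d" "nbr E v j = w" using regular_nbr_surj[OF E x(2) wn(2)] by metis
      have "u \<in> nbrs E w" using wn(1) nbrs_commute by blast
      then obtain l where l: "l < d" "nbr E w l = u" using regular_nbr_surj[OF E \<open>w < n\<close>] by metis
      have "?ok x (False, j, l)" using j l lt x by (simp add: u_def)
      then show ?thesis using \<open>j < d\<close> l(1) by (intro bexI[of _ "(False, j, l)"]) auto
    qed
  qed
  have "\<forall>x\<in>{..<n} \<times> {..<d}. \<exists>y. y \<in> UNIV \<times> {..<d} \<times> {..<d} \<and> ?ok x y"
  proof
    fix x assume "x \<in> {..<n} \<times> {..<d}"
    from ex[OF this] show "\<exists>y. y \<in> UNIV \<times> {..<d} \<times> {..<d} \<and> ?ok x y" by (simp only: Bex_def)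
  qed
  from bchoice[OF this] obtain f
    where f: "\<forall>x\<in>{..<n} \<times> {..<d}. f x \<in> UNIV \<times> {..<d} \<times> {..<d} \<and> ?ok x (f x)" ..
  define I where "I = restrict f ({..<n} \<times> {..<d})"
  have "I \<in> ({..<n} \<times> {..<d}) \<rightarrow>\<^sub>E (UNIV \<times> {..<d} \<times> {..<d})"
    unfolding I_def using f by (intro restrict_PiE_iff[THEN iffD2]) blast
  moreover have "decodes n d p E ?F I"
    unfolding decodes_def
  proof (intro allI impI)
    fix v i assume "v < n" "i < d"
    then have "?ok (v, i) (I (v, i))" using bspec[OF f, of "(v, i)"] by (simp add: I_def)
    then show "case I (v, i) of (b, j, l) \<Rightarrow> j < d \<and> l < d \<and>
     (if b then nbr E v i = nbr ?F v j
      else nbr E v i = nbr E (nbr E v j) l \<and> p (nbr E v j) < p v \<and> p (nbr E v j) < p (nbr E v i))"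
      by (simp only: prod.case)
  qed
  ultimately show ?thesis by blast
qed

section \<open>Counting the codes\<close>

lemma sum_power_div_fact_le_exp: "(\<Sum>i\<in>{..m}. x ^ i / fact i) \<le> exp x" if "x \<ge> 0" for x :: real
  using sum_le_suminf[OF summable_exp, of "{..m}" x] that
  by (simp add: exp_def divide_inverse mult.commute)

text \<open>There are at most \<open>n^(2m) / m!\<close> graphs with \<open>m\<close> edges; keeping
  the factorial makes each edge cost \<open>ln n\<close> rather than \<open>2 ln n\<close>.
  Splitting off \<open>n^m \<le> n^M\<close> leaves terms of the series of \<open>exp n\<close>, a
  loss linear in \<open>n\<close>.\<close>

lemma card_edge_sets_le:
  assumes "n \<ge> 1"
  shows "finite {F. simple_graph n F \<and> card F \<le> M}"
    and "real (card {F. simple_graph n F \<and> card F \<le> M}) \<le> real n ^ M * exp (real n)"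
proof -
  define P where "P = {e. e \<subseteq> {..<n} \<and> card e = 2}"
  have finP: "finite P" unfolding P_def by (rule finite_subset[of _ "Pow {..<n}"]) auto
  have "card P = n choose 2" using n_subsets[of "{..<n}" 2] by (simp add: P_def)
  then have cP: "card P \<le> n * n" by (simp add: choose_two) (metis diff_le_self div_le_dividend le_trans mult_le_mono2)
  have sg: "simple_graph n F \<longleftrightarrow> F \<subseteq> P" for F by (auto simp: simple_graph_def P_def)
  have eq: "{F. simple_graph n F \<and> card F \<le> M} = (\<Union>m\<in>{..M}. {F. F \<subseteq> P \<and> card F = m})"
    by (auto simp: sg)
  have fin: "finite {F. F \<subseteq> P \<and> card F = m}" for m
    using finP by (auto intro: finite_subset[of _ "Pow P"])
  show "finite {F. simple_graph n F \<and> card F \<le> M}" unfolding eq using fin by blast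
  have "card {F. simple_graph n F \<and> card F \<le> M} \<le> (\<Sum>m\<in>{..M}. card {F. F \<subseteq> P \<and> card F = m})"
    unfolding eq by (rule card_UN_le) simp
  then have "real (card {F. simple_graph n F \<and> card F \<le> M}) \<le> (\<Sum>m\<in>{..M}. real (card P choose m))"
    using n_subsets[OF finP] by (simp flip: of_nat_sum)
  also have "\<dots> \<le> (\<Sum>m\<in>{..M}. real n ^ M * (real n ^ m / fact m))"
  proof (rule sum_mono)
    fix m assume "m \<in> {..M}"
    have "real (card P choose m) \<le> real (card P) ^ m / fact m"
    proof -
      have "real ((card P choose m) * fact m) \<le> real (card P ^ m)"
        by (simp only: of_nat_le_iff binomial_fact_pow)
      then show ?thesis by (simp add: pos_le_divide_eq)
    qed
    also have "\<dots> \<le> real (n * n) ^ m / fact m"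
      using cP by (intro divide_right_mono power_mono) (simp_all only: of_nat_le_iff, simp_all)
    also have "\<dots> = real n ^ m * (real n ^ m / fact m)" by (simp add: power_mult_distrib)
    also have "\<dots> \<le> real n ^ M * (real n ^ m / fact m)"
      using assms \<open>m \<in> {..M}\<close> by (intro mult_right_mono power_increasing) auto
    finally show "real (card P choose m) \<le> real n ^ M * (real n ^ m / fact m)" .
  qed
  also have "\<dots> \<le> real n ^ M * exp (real n)"
    unfolding sum_distrib_left[symmetric]
    by (intro mult_left_mono sum_power_div_fact_le_exp) auto
  finally show "real (card {F. simple_graph n F \<and> card F \<le> M}) \<le> real n ^ M * exp (real n)" .
qed

lemma one_le_twice_ln:
  fixes x :: real
  assumes "x \<ge> 2" shows "1 \<le> 2 * ln x"
proof -
  have "(1::real) \<le> ln (2 ^ 2)" using exp_le by (subst ln_ge_iff) auto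
  also have "\<dots> = 2 * ln 2" by (subst ln_realpow) auto
  also have "\<dots> \<le> 2 * ln x" using assms by simp
  finally show ?thesis .
qed

text \<open>The paid graph and the index function determine the graph, so the orders, chosen
  separately for each graph, do not enter the count. There are \<open>(2 * d * d) ^ (n * d)\<close>
  index functions.\<close>

lemma card_regular_graphs_le:
  assumes "n \<ge> 1" "d \<ge> 2" "G \<subseteq> {E. regular_graph n d E}"
    and cost: "\<And>E. E \<in> G \<Longrightarrow> (\<Sum>e\<in>E. 2 / (real (card (common E e)) + 2)) \<le> B"
  shows "real (card G) \<le> exp (B * ln (real n) + 4 * real n * real d * ln (real d))"
proof (cases "G = {}")
  case False
  then obtain E0 where "E0 \<in> G" by blast
  have "0 \<le> (\<Sum>e\<in>E0. 2 / (real (card (common E0 e)) + 2))" by (intro sum_nonneg) simp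
  then have "B \<ge> 0" using cost[OF \<open>E0 \<in> G\<close>] by linarith
  define M where "M = nat \<lfloor>B\<rfloor>"
  define CF where "CF = {F. simple_graph n F \<and> card F \<le> M}"
  define CI where "CI = ({..<n} \<times> {..<d}) \<rightarrow>\<^sub>E ((UNIV :: bool set) \<times> {..<d} \<times> {..<d})"
  have "\<exists>p I. p permutes {..<n} \<and> paid p E \<in> CF \<and> I \<in> CI \<and> decodes n d p E (paid p E) I"
    if "E \<in> G" for E
  proof -
    have reg: "regular_graph n d E" using that assms(3) by blast
    then have sg: "simple_graph n E" by (rule regular_graphD)
    obtain p where p: "p permutes {..<n}"
      "real (card (paid p E)) \<le> (\<Sum>e\<in>E. 2 / (real (card (common E e)) + 2))"
      using exists_cheap_order[OF sg] by blast
    then have "real (card (paid p E)) \<le> B" using cost[OF that] by linarith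
    then have "card (paid p E) \<le> M" unfolding M_def by linarith
    moreover have "simple_graph n (paid p E)" using sg by (auto simp: simple_graph_def paid_def)
    ultimately show ?thesis using exists_code[OF reg p(1)] p(1) by (auto simp: CF_def CI_def)
  qed
  then obtain p I where pI: "\<And>E. E \<in> G \<Longrightarrow> paid (p E) E \<in> CF \<and> I E \<in> CI \<and> decodes n d (p E) E (paid (p E) E) (I E)"
    by metis
  have finCI: "finite CI" unfolding CI_def by (intro finite_PiE) auto
  have finCF: "finite CF" unfolding CF_def by (rule card_edge_sets_le[OF assms(1)])
  have "card G \<le> card (CF \<times> CI)"
  proof (rule card_inj_on_le[where f = "\<lambda>E. (paid (p E) E, I E)"])
    show "inj_on (\<lambda>E. (paid (p E) E, I E)) G"
    proof (rule inj_onI)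
      fix E E' assume a: "E \<in> G" "E' \<in> G" "(paid (p E) E, I E) = (paid (p E') E', I E')"
      have "decodes n d (p E) E (paid (p E) E) (I E)" using pI a(1) by blast
      moreover have "decodes n d (p E') E' (paid (p E) E) (I E)" using pI a(2,3) by force
      ultimately show "E = E'" using a(1,2) assms(3) by (intro decodes_unique) blast+
    qed
  qed (use pI finCI finCF in auto)
  also have "card (CF \<times> CI) = card CF * (2 * d * d) ^ (n * d)"
    by (simp add: card_cartesian_product CI_def card_PiE power_mult_distrib)
  finally have "real (card G) \<le> real (card CF * (2 * d * d) ^ (n * d))"
    by (simp only: of_nat_le_iff)
  also have "\<dots> = real (card CF) * (2 * real d * real d) ^ (n * d)" by simp
  also have "\<dots> \<le> real n ^ M * exp (real n) * (2 * real d * real d) ^ (n * d)"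
    using card_edge_sets_le(2)[OF assms(1), of M] by (intro mult_right_mono) (auto simp: CF_def)
  also have "\<dots> = exp (real M * ln (real n) + real n + real (n * d) * (ln 2 + ln (real d) + ln (real d)))"
  proof -
    have "real n ^ M = exp (real M * ln (real n))" using assms(1) by (simp add: exp_of_nat_mult)
    moreover have "exp (ln 2 + ln (real d) + ln (real d)) = 2 * real d * real d"
      unfolding exp_add using assms(2) by simp
    then have "(2 * real d * real d) ^ (n * d) = exp (real (n * d) * (ln 2 + ln (real d) + ln (real d)))"
      by (simp only: exp_of_nat_mult)
    ultimately show ?thesis by (simp add: exp_add)
  qed
  \<comment> \<open>Each index contributes \<open>ln (2 * d * d) \<le> 3 * ln d\<close>; the term
    \<open>n\<close> from the edge sets is absorbed by the fourth
    \<open>n * d * ln d\<close>.\<close>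
  also have "\<dots> \<le> exp (B * ln (real n) + 4 * real n * real d * ln (real d))"
  proof -
    have "real M \<le> B" using \<open>B \<ge> 0\<close> by (simp add: M_def)
    then have 1: "real M * ln (real n) \<le> B * ln (real n)" using assms(1) by (intro mult_right_mono) auto
    have l2: "ln 2 \<le> ln (real d)" using assms(2) by simp
    have "1 \<le> 2 * ln (real d)" using one_le_twice_ln assms(2) by simp
    also have "\<dots> \<le> real d * ln (real d)" using assms(2) by (intro mult_right_mono) auto
    finally have 2: "real n * 1 \<le> real n * (real d * ln (real d))" by (intro mult_left_mono) auto
    have 3: "real (n * d) * (ln 2 + ln (real d) + ln (real d)) \<le> real (n * d) * (3 * ln (real d))"
      using l2 by (intro mult_left_mono) auto
    show ?thesis using 1 2 3 by (simp add: algebra_simps)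
  qed
  finally show ?thesis .
qed simp

section \<open>Triangles, cliques and bad nodes\<close>

lemma card_incident_edges:
  assumes "simple_graph n E"
  shows "card {e \<in> E. v \<in> e} = card (nbrs E v)"
proof -
  have "{e \<in> E. v \<in> e} = (\<lambda>u. {u, v}) ` nbrs E v"
  proof (intro equalityI subsetI)
    fix e assume e: "e \<in> {e \<in> E. v \<in> e}"
    then obtain x y where "e = {x, y}" "x \<noteq> y" using simple_graph_edgeE[OF assms] by blast
    then obtain u where "e = {u, v}" using e by auto
    then show "e \<in> (\<lambda>u. {u, v}) ` nbrs E v" using e by (auto simp: nbrs_def)
  qed (auto simp: nbrs_def)
  moreover have "inj_on (\<lambda>u. {u, v}) (nbrs E v)" by (auto simp: inj_on_def doubleton_eq_iff)
  ultimately show ?thesis by (simp add: card_image)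
qed

lemma sum_vertices_incident_le:
  assumes "simple_graph n E" "F \<subseteq> E" "V \<subseteq> {..<n}"
  shows "(\<Sum>v\<in>V. card {e \<in> F. v \<in> e}) \<le> 2 * card F"
proof -
  have fin: "finite F" "finite V" using assms simple_graph_finite finite_subset by blast+
  have "(\<Sum>v\<in>V. card {e \<in> F. v \<in> e}) = (\<Sum>e\<in>F. card {v \<in> V. v \<in> e})"
    by (rule sum_multicount_gen[OF fin(2,1)]) simp
  also have "\<dots> \<le> (\<Sum>e\<in>F. 2)"
  proof (rule sum_mono)
    fix e assume "e \<in> F"
    then have "card e = 2" using assms by (auto simp: simple_graph_def)
    then have "finite e" using card.infinite by fastforce
    then show "card {v \<in> V. v \<in> e} \<le> 2"
      using card_mono[of e "{v \<in> V. v \<in> e}"] \<open>card e = 2\<close> by auto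
  qed
  finally show ?thesis by simp
qed

lemma handshake:
  assumes "regular_graph n d E" shows "2 * card E = n * d"
proof -
  note sg = regular_graphD(1)[OF assms]
  have "n * d = (\<Sum>v<n. card {e \<in> E. v \<in> e})"
    using card_incident_edges[OF sg] regular_graphD(2)[OF assms] by simp
  also have "\<dots> = (\<Sum>e\<in>E. card {v \<in> {..<n}. v \<in> e})"
    by (rule sum_multicount_gen) (simp_all add: simple_graph_finite[OF sg])
  also have "\<dots> = (\<Sum>e\<in>E. 2)"
  proof (rule sum.cong[OF refl])
    fix e assume "e \<in> E"
    then have "card e = 2" "{v \<in> {..<n}. v \<in> e} = e" using sg by (auto simp: simple_graph_def)
    then show "card {v \<in> {..<n}. v \<in> e} = 2" by simp
  qed
  finally show ?thesis by simp
qed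

lemma card_common_less:
  assumes "regular_graph n d E" "e \<in> E"
  shows "card (common E e) < d"
proof -
  note sg = regular_graphD(1)[OF assms(1)]
  obtain u v where e: "e = {u, v}" "u \<noteq> v" "u < n" "v < n"
    using simple_graph_edgeE[OF sg assms(2)] by blast
  have "v \<in> nbrs E u" "v \<notin> common E e"
  proof -
    have "u \<in> nbrs E v" using assms(2) e(1) by (simp add: nbrs_def)
    then show "v \<in> nbrs E u" using nbrs_commute by blast
    show "v \<notin> common E e" using nbrs_subset[OF sg, of v] unfolding e(1) common_pair by blast
  qed
  then have "common E e \<subset> nbrs E u" using e by (auto simp: common_pair)
  from psubset_card_mono[OF regular_graphD(3)[OF assms(1)] this] show ?thesis
    using regular_graphD(2)[OF assms(1) e(3)] by simp
qed

section \<open>Clique counts bound triangle counts\<close>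

lemma finite_cliques: "finite (cliques n k E)"
  by (rule finite_subset[of _ "Pow {..<n}"]) (auto simp: cliques_def)

lemma clique_edges:
  assumes "simple_graph n E" "S \<in> cliques n k E"
  shows "{e \<in> E. e \<subseteq> S} = {e. e \<subseteq> S \<and> card e = 2}"
  using assms by (auto simp: simple_graph_def cliques_def is_clique_def card_2_iff)

lemma sum_cliques_edges:
  assumes "simple_graph n E"
  shows "(\<Sum>e\<in>E. card {S \<in> cliques n k E. e \<subseteq> S}) = (k choose 2) * card (cliques n k E)"
proof (rule sum_multicount[OF simple_graph_finite[OF assms] finite_cliques])
  show "\<forall>S\<in>cliques n k E. card {e \<in> E. e \<subseteq> S} = k choose 2"
  proof
    fix S assume S: "S \<in> cliques n k E"
    then have "finite S" "card S = k" by (auto simp: cliques_def intro: finite_subset)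
    then show "card {e \<in> E. e \<subseteq> S} = k choose 2"
      using clique_edges[OF assms S] n_subsets[of S 2] by simp
  qed
qed

text \<open>Deleting the two ends from a clique through \<open>e\<close> leaves \<open>k - 2\<close>
  common neighbours and loses no information.\<close>

lemma card_cliques_edge_le:
  assumes "simple_graph n E" "e \<in> E"
  shows "card {S \<in> cliques n k E. e \<subseteq> S} \<le> card (common E e) choose (k - 2)"
proof -
  obtain u v where e: "e = {u, v}" "u \<noteq> v" using simple_graph_edgeE[OF assms] by metis
  have fin: "finite (common E e)" using finite_nbrs[OF assms(1)] by (simp add: e common_pair)
  have "card {S \<in> cliques n k E. e \<subseteq> S} \<le> card {T. T \<subseteq> common E e \<and> card T = k - 2}"
  proof (rule card_inj_on_le[where f = "\<lambda>S. S - e"])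
    show "inj_on (\<lambda>S. S - e) {S \<in> cliques n k E. e \<subseteq> S}" by (auto simp: inj_on_def)
    show "(\<lambda>S. S - e) ` {S \<in> cliques n k E. e \<subseteq> S} \<subseteq> {T. T \<subseteq> common E e \<and> card T = k - 2}"
    proof clarify
      fix S assume S: "S \<in> cliques n k E" "e \<subseteq> S"
      then have "card (S - e) = k - 2" using e by (simp add: card_Diff_subset cliques_def)
      moreover have "S - e \<subseteq> common E e"
      proof
        fix x assume x: "x \<in> S - e"
        have "{x, y} \<in> E" if "y \<in> e" for y
        proof -
          have "is_clique E S" using S(1) by (simp add: cliques_def)
          moreover have "x \<in> S" "y \<in> S" "x \<noteq> y" using x S(2) that by auto
          ultimately show ?thesis by (simp add: is_clique_def)
        qed
        then show "x \<in> common E e" by (simp add: common_def)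
      qed
      ultimately show "S - e \<subseteq> common E e \<and> card (S - e) = k - 2" by blast
    qed
    show "finite {T. T \<subseteq> common E e \<and> card T = k - 2}" using fin by simp
  qed
  then show ?thesis using n_subsets[OF fin] by simp
qed

text \<open>The ratio of \<open>x choose j\<close> to \<open>x\<close> equals
  \<open>(x - 1) choose (j - 1)\<close> over \<open>j\<close>, which grows with \<open>x\<close>. So
  the binomial lies below its chord from \<open>0\<close> to \<open>m\<close>, which makes clique
  counts linear in triangle counts.\<close>

lemma binomial_le_chord:
  fixes t m j :: nat
  assumes "t \<le> m" "j \<ge> 1"
  shows "(t choose j) * m \<le> t * (m choose j)"
proof -
  obtain i where j: "j = Suc i" using assms(2) by (cases j) auto
  have *: "j * (x choose j) = x * ((x - 1) choose i)" for x
    using binomial_absorption[of i x] by (simp add: j)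
  have "j * ((t choose j) * m) = t * ((t - 1) choose i) * m" using *[of t] by (metis mult.assoc)
  also have "\<dots> \<le> t * ((m - 1) choose i) * m"
    using assms(1) by (intro mult_right_mono mult_left_mono binomial_right_mono) auto
  also have "\<dots> = j * (t * (m choose j))" using *[of m] by (metis mult.assoc mult.commute)
  finally show ?thesis using assms(2) by simp
qed

text \<open>Count pairs of a clique and one of its edges: by cliques, \<open>k choose 2\<close>
  each; by edges, at most the chord value with \<open>m = d - 1\<close> and
  \<open>j = k - 2\<close>. The parameter \<open>k\<close> then cancels, leaving \<open>c\<close>
  times the value reached by disjoint copies of \<open>K_(d+1)\<close>.\<close>

lemma sum_common_ge:
  assumes E: "E \<in> Gdck d c k n" and k: "k \<ge> 3" "d \<ge> k - 1"
  shows "c * real n * real d * (real d - 1) / 2 \<le> (\<Sum>e\<in>E. real (card (common E e)))"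
proof -
  have reg: "regular_graph n d E" and cl: "real (card (cliques n k E)) \<ge> c * real (d choose (k - 1)) * real n / real k"
    using E by (auto simp: Gdck_def)
  note sg = regular_graphD(1)[OF reg]
  let ?N = "card (cliques n k E)" and ?b = "(d - 1) choose (k - 2)"
  have "(k choose 2) * ?N * (d - 1) = (\<Sum>e\<in>E. card {S \<in> cliques n k E. e \<subseteq> S} * (d - 1))"
    by (simp add: sum_cliques_edges[OF sg] sum_distrib_right[symmetric])
  also have "\<dots> \<le> (\<Sum>e\<in>E. card (common E e) * ?b)"
  proof (rule sum_mono)
    fix e assume e: "e \<in> E"
    have "card {S \<in> cliques n k E. e \<subseteq> S} * (d - 1) \<le> (card (common E e) choose (k - 2)) * (d - 1)"
      by (intro mult_right_mono card_cliques_edge_le[OF sg e]) simp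
    also have "\<dots> \<le> card (common E e) * ?b"
      using card_common_less[OF reg e] k by (intro binomial_le_chord) auto
    finally show "card {S \<in> cliques n k E. e \<subseteq> S} * (d - 1) \<le> card (common E e) * ?b" .
  qed
  finally have 1: "(k choose 2) * ?N * (d - 1) \<le> (\<Sum>e\<in>E. card (common E e)) * ?b"
    by (simp add: sum_distrib_right)
  have "real (k choose 2) * real ?N * (real d - 1) = real ((k choose 2) * ?N * (d - 1))"
    using k by (simp add: of_nat_diff)
  also have "\<dots> \<le> real ((\<Sum>e\<in>E. card (common E e)) * ?b)" using 1 by (simp only: of_nat_le_iff)
  finally have 2: "real (k choose 2) * real ?N * (real d - 1) \<le> (\<Sum>e\<in>E. real (card (common E e))) * real ?b"
    by simp
  \<comment> \<open>Absorption trades the \<open>d choose (k - 1)\<close> of the density hypothesis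
    for the binomial \<open>?b\<close> from the chord, so that \<open>?b\<close> can be cancelled at
    the end.\<close>
  have "(k - 1) * (d choose (k - 1)) = d * ?b"
  proof -
    have "k - 1 = Suc (k - 2)" using k by simp
    then show ?thesis using binomial_absorption[of "k - 2" d] by (simp only: diff_diff_left)
  qed
  then have 3: "(real k - 1) * real (d choose (k - 1)) = real d * real ?b"
    using k by (metis of_nat_1 of_nat_diff of_nat_mult one_le_numeral order_trans)
  have c2: "real (k choose 2) = real k * (real k - 1) / 2"
    using k by (simp add: choose_two real_of_nat_div of_nat_diff)
  have "c * real n * real d * (real d - 1) / 2 * real ?b
      = (c * real n / 2) * (real d * real ?b) * (real d - 1)" by simp
  also have "\<dots> = real k * (real k - 1) / 2 * (c * real (d choose (k - 1)) * real n / real k) * (real d - 1)"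
    unfolding 3[symmetric] using k by (simp add: field_simps)
  also have "\<dots> \<le> real k * (real k - 1) / 2 * real ?N * (real d - 1)"
    using k cl by (intro mult_right_mono mult_left_mono) auto
  also have "\<dots> \<le> (\<Sum>e\<in>E. real (card (common E e))) * real ?b" using 2 c2 by simp
  finally show ?thesis
  proof (rule mult_right_le_imp_le)
    show "0 < real ?b" using k by simp
  qed
qed

section \<open>Bad nodes and edges strictly below the chord\<close>

definition mixed_edges :: "nat \<Rightarrow> nat set set \<Rightarrow> nat set set" where
  "mixed_edges d E = {e \<in> E. 0 < card (common E e) \<and> card (common E e) + 1 < d}"

text \<open>Otherwise every edge at \<open>v\<close> lies in no triangle or in the maximal number
  \<open>d - 1\<close>. A triangle \<open>u, v, w\<close> makes \<open>u\<close> adjacent to all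
  other neighbours of \<open>v\<close>; then \<open>u\<close> closes a triangle on every other edge
  at \<open>v\<close>, so all are maximal and \<open>v\<close> with its neighbours is a
  \<open>K_(d+1)\<close>.\<close>

lemma bad_node_mixed_edge:
  assumes reg: "regular_graph n d E" and k: "k \<ge> 3" and v: "v \<in> bad_nodes n d k E"
  shows "\<exists>e\<in>mixed_edges d E. v \<in> e"
proof (rule ccontr)
  assume "\<not> ?thesis"
  then have nomix: "card (common E e) = 0 \<or> card (common E e) = d - 1" if "e \<in> E" "v \<in> e" for e
    using that card_common_less[OF reg that(1)] unfolding mixed_edges_def by fastforce
  note sg = regular_graphD(1)[OF reg]
  have vn: "v < n" using v by (simp add: bad_nodes_def)
  have fin: "finite (common E {x, v})" for x using finite_nbrs[OF sg] by (simp add: common_pair)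
  have full: "nbrs E v - {x} \<subseteq> nbrs E x" if x: "x \<in> nbrs E v" "common E {x, v} \<noteq> {}" for x
  proof -
    have e: "{x, v} \<in> E" using x by (simp add: nbrs_def)
    have "card (common E {x, v}) \<noteq> 0" using x(2) fin by simp
    then have "card (common E {x, v}) = d - 1" using nomix[OF e] by simp
    moreover have "card (nbrs E v - {x}) = d - 1" using x(1) regular_graphD(2)[OF reg vn] by simp
    moreover have "common E {x, v} \<subseteq> nbrs E v - {x}"
      using nbrs_subset[OF sg, of x] by (auto simp: common_pair)
    ultimately have "common E {x, v} = nbrs E v - {x}"
      using finite_nbrs[OF sg] by (intro card_subset_eq) auto
    then show ?thesis by (auto simp: common_pair)
  qed
  obtain S where S: "S \<in> cliques n k E" "v \<in> S" using v by (auto simp: bad_nodes_def)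
  have fS: "finite S" "card S = k" "is_clique E S"
    using S(1) by (auto simp: cliques_def intro: finite_subset)
  have "card (S - {v}) \<ge> 2" using fS S(2) k by simp
  then obtain u w where uw: "u \<in> S - {v}" "w \<in> S - {v}" "u \<noteq> w"
    by (metis card_le_Suc0_iff_eq fS(1) finite_Diff numeral_2_eq_2 not_less_eq_eq)
  have u: "u \<in> nbrs E v" "w \<in> common E {u, v}"
    using uw fS(3) S(2) by (auto simp: nbrs_def common_def is_clique_def)
  have fu: "nbrs E v - {u} \<subseteq> nbrs E u" using full u by blast
  have all: "nbrs E v - {x} \<subseteq> nbrs E x" if "x \<in> nbrs E v" for x
  proof (cases "x = u")
    case False
    then have "u \<in> common E {x, v}" using that fu u(1) nbrs_commute by (auto simp: common_pair)
    then show ?thesis using full[OF that] by blast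
  qed (use fu in simp)
  define K where "K = insert v (nbrs E v)"
  have "v \<notin> nbrs E v" using nbrs_subset[OF sg, of v] by blast
  then have "card K = d + 1" using finite_nbrs[OF sg] regular_graphD(2)[OF reg vn] by (simp add: K_def)
  moreover have "K \<subseteq> {..<n}" using nbrs_subset[OF sg, of v] vn by (auto simp: K_def)
  moreover have "is_clique E K"
    unfolding is_clique_def
  proof (intro ballI impI)
    fix x y assume xy: "x \<in> K" "y \<in> K" "x \<noteq> y"
    then have "x \<in> nbrs E y"
      using all[of y] nbrs_commute[of x E v] nbrs_commute[of y E v] unfolding K_def by auto
    then show "{x, y} \<in> E" by (simp add: nbrs_def)
  qed
  ultimately have "K \<in> cliques n (d + 1) E" by (simp add: cliques_def)
  then show False using v by (auto simp: bad_nodes_def K_def)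
qed

lemma card_bad_nodes_le:
  assumes "regular_graph n d E" "k \<ge> 3"
  shows "card (bad_nodes n d k E) \<le> 2 * card (mixed_edges d E)"
proof -
  note sg = regular_graphD(1)[OF assms(1)]
  have fin: "finite (mixed_edges d E)"
    using simple_graph_finite[OF sg] by (simp add: mixed_edges_def)
  have "card (bad_nodes n d k E) = (\<Sum>v\<in>bad_nodes n d k E. 1)" by simp
  also have "\<dots> \<le> (\<Sum>v\<in>bad_nodes n d k E. card {e \<in> mixed_edges d E. v \<in> e})"
  proof (rule sum_mono)
    fix v assume "v \<in> bad_nodes n d k E"
    then have "{e \<in> mixed_edges d E. v \<in> e} \<noteq> {}"
      using bad_node_mixed_edge[OF assms] by blast
    then have "card {e \<in> mixed_edges d E. v \<in> e} \<noteq> 0" using fin by simp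
    then show "1 \<le> card {e \<in> mixed_edges d E. v \<in> e}" by linarith
  qed
  also have "\<dots> \<le> 2 * card (mixed_edges d E)"
    by (rule sum_vertices_incident_le[OF sg]) (auto simp: mixed_edges_def bad_nodes_def)
  finally show ?thesis .
qed

text \<open>The function \<open>2 / (t + 2)\<close> lies below its chord \<open>1 - t / (d + 1)\<close> on \<open>[0, d - 1]\<close>,
  strictly so in the interior.\<close>

lemma edge_cost_le:
  fixes t d :: nat
  assumes "t < d"
  shows "2 / (real t + 2) \<le> 1 - real t / (real d + 1)"
    and "0 < t \<Longrightarrow> t + 1 < d \<Longrightarrow> 2 / (real t + 2) \<le> 1 - real t / (real d + 1) - 1 / (real d + 1) ^ 2"
proof -
  \<comment> \<open>The gap between chord and cost, factored so that its zeros \<open>0\<close> and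
    \<open>d - 1\<close> are visible.\<close>
  have eq: "1 - real t / (real d + 1) - 2 / (real t + 2)
      = real t * (real d - 1 - real t) / ((real t + 2) * (real d + 1))"
    by (simp add: divide_simps) (simp add: algebra_simps)
  have "0 \<le> real t * (real d - 1 - real t) / ((real t + 2) * (real d + 1))"
    using assms by (intro divide_nonneg_nonneg mult_nonneg_nonneg) auto
  then show "2 / (real t + 2) \<le> 1 - real t / (real d + 1)" using eq by linarith
  assume t: "0 < t" "t + 1 < d"
  \<comment> \<open>Both factors of the numerator are at least \<open>1\<close>, and
    \<open>t + 2 \<le> d + 1\<close> in the denominator.\<close>
  have "1 * 1 \<le> real t * (real d - 1 - real t)" using t by (intro mult_mono) auto
  then have "1 / (real d + 1) ^ 2 \<le> real t * (real d - 1 - real t) / ((real t + 2) * (real d + 1))"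
    unfolding power2_eq_square using t by (intro frac_le mult_right_mono) auto
  then show "2 / (real t + 2) \<le> 1 - real t / (real d + 1) - 1 / (real d + 1) ^ 2"
    using eq by linarith
qed

text \<open>Sum the chord inequality over the \<open>n * d / 2\<close> edges. The triangle bound
  controls the linear part, and the mixed edges, at least half as many as the bad nodes, each save
  an extra \<open>1 / (d + 1) ^ 2\<close>.\<close>

lemma cost_le:
  assumes E: "E \<in> Gdck d c k n" and k: "k \<ge> 3" "d \<ge> k - 1"
  shows "(\<Sum>e\<in>E. 2 / (real (card (common E e)) + 2))
    \<le> real d / 2 * real n * (1 - c * ((real d - 1) / (real d + 1)))
       - real (card (bad_nodes n d k E)) / (2 * (real d + 1) ^ 2)"
proof -
  let ?t = "\<lambda>e. real (card (common E e))"
  have reg: "regular_graph n d E" using E by (simp add: Gdck_def)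
  have finE: "finite E" using simple_graph_finite regular_graphD(1)[OF reg] by blast
  have "(\<Sum>e\<in>E. 2 / (?t e + 2))
      \<le> (\<Sum>e\<in>E. 1 - ?t e / (real d + 1) - (if e \<in> mixed_edges d E then 1 / (real d + 1) ^ 2 else 0))"
  proof (rule sum_mono)
    fix e assume "e \<in> E"
    then show "2 / (?t e + 2) \<le> 1 - ?t e / (real d + 1) - (if e \<in> mixed_edges d E then 1 / (real d + 1) ^ 2 else 0)"
      using edge_cost_le[OF card_common_less[OF reg]] by (auto simp: mixed_edges_def)
  qed
  also have "\<dots> = real (card E) - (\<Sum>e\<in>E. ?t e) / (real d + 1)
      - (\<Sum>e\<in>E. if e \<in> mixed_edges d E then 1 / (real d + 1) ^ 2 else 0)"
    by (simp add: sum_subtractf sum_divide_distrib)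
  also have "(\<Sum>e\<in>E. if e \<in> mixed_edges d E then 1 / (real d + 1) ^ 2 else 0)
      = real (card (mixed_edges d E)) / (real d + 1) ^ 2"
    using finE by (simp add: sum.If_cases mixed_edges_def Int_def cong: conj_cong)
  also have "real (card E) = real n * real d / 2"
    using arg_cong[OF handshake[OF reg], of real] by simp
  finally have 1: "(\<Sum>e\<in>E. 2 / (?t e + 2)) \<le> real n * real d / 2 - (\<Sum>e\<in>E. ?t e) / (real d + 1)
      - real (card (mixed_edges d E)) / (real d + 1) ^ 2" .
  have "(c * real n * real d * (real d - 1) / 2) / (real d + 1) \<le> (\<Sum>e\<in>E. ?t e) / (real d + 1)"
    by (intro divide_right_mono sum_common_ge[OF E k]) auto
  moreover have "real (card (bad_nodes n d k E)) / (2 * (real d + 1) ^ 2)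
      \<le> real (card (mixed_edges d E)) / (real d + 1) ^ 2"
  proof -
    have "real (card (bad_nodes n d k E)) / (2 * (real d + 1) ^ 2)
       \<le> real (2 * card (mixed_edges d E)) / (2 * (real d + 1) ^ 2)"
      using card_bad_nodes_le[OF reg k(1)] by (intro divide_right_mono) (simp_all only: of_nat_le_iff, simp)
    then show ?thesis by simp
  qed
  moreover have "real d / 2 * real n * (1 - c * ((real d - 1) / (real d + 1)))
      = real n * real d / 2 - (c * real n * real d * (real d - 1) / 2) / (real d + 1)"
    by (simp add: field_simps)
  ultimately show ?thesis using 1 by linarith
qed

section \<open>Lifts\<close>

definition relabel :: "('a \<Rightarrow> nat) \<Rightarrow> 'a set \<Rightarrow> ('a \<Rightarrow> 'a \<Rightarrow> bool) \<Rightarrow> nat set set" where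
  "relabel f V R = {{f a, f b} | a b. a \<in> V \<and> b \<in> V \<and> R a b}"

lemma relabel_iff:
  assumes "inj_on f V" "symp R" "a \<in> V" "b \<in> V"
  shows "{f a, f b} \<in> relabel f V R \<longleftrightarrow> R a b"
proof
  assume "{f a, f b} \<in> relabel f V R"
  then obtain a' b' where *: "{f a, f b} = {f a', f b'}" "a' \<in> V" "b' \<in> V" "R a' b'"
    unfolding relabel_def by blast
  from *(1) have "f a = f a' \<and> f b = f b' \<or> f a = f b' \<and> f b = f a'" by (simp add: doubleton_eq_iff)
  then have "a = a' \<and> b = b' \<or> a = b' \<and> b = a'"
    using assms *(2,3) by (simp add: inj_on_eq_iff)
  then show "R a b" using *(4) assms(2) by (auto dest: sympD)
qed (use assms in \<open>auto simp: relabel_def\<close>)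

lemma regular_graph_relabel:
  assumes f: "bij_betw f V {..<n}" and R: "symp R" "irreflp R"
    and deg: "\<And>a. a \<in> V \<Longrightarrow> card {b \<in> V. R a b} = d"
  shows "regular_graph n d (relabel f V R)"
  unfolding regular_graph_def
proof (intro conjI allI impI)
  have inj: "inj_on f V" and img: "f ` V = {..<n}" using f by (auto simp: bij_betw_def)
  show sg: "simple_graph n (relabel f V R)"
    unfolding simple_graph_def
  proof
    fix e assume "e \<in> relabel f V R"
    then obtain a b where ab: "e = {f a, f b}" "a \<in> V" "b \<in> V" "R a b"
      unfolding relabel_def by blast
    then have "a \<noteq> b" using R(2) by (auto dest: irreflpD)
    then have "f a \<noteq> f b" using ab inj by (simp add: inj_on_eq_iff)
    then show "e \<subseteq> {..<n} \<and> card e = 2" using ab img by auto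
  qed
  fix v assume "v < n"
  then obtain a where a: "a \<in> V" "v = f a" using img by auto
  have "nbrs (relabel f V R) v = f ` {b \<in> V. R a b}"
  proof (intro equalityI subsetI)
    fix u assume u: "u \<in> nbrs (relabel f V R) v"
    then have "u < n" using nbrs_subset[OF sg] by blast
    then obtain b where b: "b \<in> V" "u = f b" using img by auto
    then have "R b a" using u a relabel_iff[OF inj R(1)] by (simp add: nbrs_def)
    then show "u \<in> f ` {b \<in> V. R a b}" using b R(1) by (auto dest: sympD)
  next
    fix u assume "u \<in> f ` {b \<in> V. R a b}"
    then obtain b where b: "b \<in> V" "u = f b" "R a b" by auto
    then have "R b a" using R(1) by (auto dest: sympD)
    then show "u \<in> nbrs (relabel f V R) v"
      using a b relabel_iff[OF inj R(1)] by (simp add: nbrs_def)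
  qed
  moreover have "inj_on f {b \<in> V. R a b}" using inj by (rule inj_on_subset) auto
  ultimately show "degree (relabel f V R) v = d"
    using deg[OF a(1)] by (simp add: degree_eq_card_nbrs card_image)
qed

lemma card_cliques_disjoint_ge:
  assumes "k \<ge> 1" "\<And>j. j < A \<Longrightarrow> K j \<in> cliques n m E"
    and "\<And>i j. i < A \<Longrightarrow> j < A \<Longrightarrow> i \<noteq> j \<Longrightarrow> K i \<inter> K j = {}"
  shows "A * (m choose k) \<le> card (cliques n k E)"
proof -
  define P where "P j = {T. T \<subseteq> K j \<and> card T = k}" for j
  have fK: "finite (K j)" "card (K j) = m" if "j < A" for j
    using assms(2)[OF that] by (auto simp: cliques_def intro: finite_subset)
  have "A * (m choose k) = (\<Sum>j<A. card (P j))"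
    using n_subsets[OF fK(1)] fK(2) by (simp add: P_def)
  also have "\<dots> = card (\<Union>j<A. P j)"
  proof (rule card_UN_disjoint[symmetric])
    show "\<forall>j\<in>{..<A}. finite (P j)" using fK by (simp add: P_def)
    show "\<forall>i\<in>{..<A}. \<forall>j\<in>{..<A}. i \<noteq> j \<longrightarrow> P i \<inter> P j = {}"
    proof (intro ballI impI)
      fix i j assume ij: "i \<in> {..<A}" "j \<in> {..<A}" "i \<noteq> j"
      have "T = {}" if "T \<in> P i \<inter> P j" for T
        using that assms(3)[of i j] ij by (auto simp: P_def)
      \<comment> \<open>Disjoint cliques share only the empty subset, which \<open>k \<ge> 1\<close>
        excludes.\<close>
      moreover have "{} \<notin> P i" using assms(1) by (simp add: P_def)
      ultimately show "P i \<inter> P j = {}" by blast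
    qed
  qed simp
  also have "\<dots> \<le> card (cliques n k E)"
  proof (rule card_mono[OF finite_cliques])
    show "(\<Union>j<A. P j) \<subseteq> cliques n k E"
    proof
      fix T assume "T \<in> (\<Union>j<A. P j)"
      then obtain j where j: "j < A" "T \<subseteq> K j" "card T = k" by (auto simp: P_def)
      then have "K j \<subseteq> {..<n}" "is_clique E (K j)" using assms(2)[of j] by (auto simp: cliques_def)
      then show "T \<in> cliques n k E" using j(2,3) unfolding cliques_def is_clique_def by blast
    qed
  qed
  finally show ?thesis .
qed

text \<open>Vertices \<open>(0, i, x)\<close> form an \<open>A\<close>-fold lift of \<open>K\<^sub>d\<^sub>+\<^sub>1\<close> that is trivial, i.e. consists of \<open>A\<close>
  disjoint cliques; vertices \<open>(1, i, x)\<close> and \<open>(2, i, x)\<close> form the two sides of an arbitrary \<open>s\<close>-fold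
  lift of \<open>K\<^sub>d\<^sub>,\<^sub>d\<close>.\<close>

definition lift_verts :: "nat \<Rightarrow> nat \<Rightarrow> nat \<Rightarrow> (nat \<times> nat \<times> nat) set" where
  "lift_verts d A s = {0} \<times> {..d} \<times> {..<A} \<union> {1, 2} \<times> {..<d} \<times> {..<s}"

text \<open>The identity in fibre \<open>0\<close> numbers the cliques by their vertices in that
  fibre; with a free permutation there, renumbering the cliques would produce the same graph several
  times.\<close>

definition from_one :: "(nat \<Rightarrow> 'a \<Rightarrow> 'a) \<Rightarrow> nat \<Rightarrow> 'a \<Rightarrow> 'a" where
  "from_one \<sigma> i = (if i = 0 then id else \<sigma> i)"

text \<open>\<open>from_one \<sigma> i x\<close> is the number of the clique containing
  \<open>(0, i, x)\<close>; \<open>\<pi> (i, j)\<close> is the perfect matching between fibre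
  \<open>i\<close> on side \<open>1\<close> and fibre \<open>j\<close> on side
  \<open>2\<close>.\<close>

fun lift_adj :: "(nat \<Rightarrow> nat \<Rightarrow> nat) \<Rightarrow> (nat \<times> nat \<Rightarrow> nat \<Rightarrow> nat) \<Rightarrow> nat \<times> nat \<times> nat \<Rightarrow> nat \<times> nat \<times> nat \<Rightarrow> bool" where
  "lift_adj \<sigma> \<pi> (a, i, x) (b, j, y) \<longleftrightarrow>
     a = 0 \<and> b = 0 \<and> i \<noteq> j \<and> from_one \<sigma> i x = from_one \<sigma> j y \<or>
     a = 1 \<and> b = 2 \<and> \<pi> (i, j) x = y \<or>
     a = 2 \<and> b = 1 \<and> \<pi> (j, i) y = x"

lemma card_lift_verts: "card (lift_verts d A s) = (d + 1) * A + 2 * d * s"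
  and finite_lift_verts: "finite (lift_verts d A s)"
proof -
  have "card (lift_verts d A s) = card ({0::nat} \<times> {..d} \<times> {..<A}) + card ({1::nat, 2} \<times> {..<d} \<times> {..<s})"
    unfolding lift_verts_def by (rule card_Un_disjoint) auto
  then show "card (lift_verts d A s) = (d + 1) * A + 2 * d * s"
    by (simp add: card_cartesian_product)
qed (simp add: lift_verts_def)

lemma symp_lift_adj: "symp (lift_adj \<sigma> \<pi>)"
  by (rule sympI) (auto elim!: lift_adj.elims)

lemma irreflp_lift_adj: "irreflp (lift_adj \<sigma> \<pi>)"
  by (rule irreflpI) (auto elim!: lift_adj.elims)

lemma from_one_permutes:
  assumes "\<sigma> \<in> {1..d} \<rightarrow>\<^sub>E {p. p permutes X}" "i \<le> d"
  shows "from_one \<sigma> i permutes X"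
  using assms by (auto simp: from_one_def PiE_iff permutes_id)

text \<open>A vertex has exactly one neighbour in each of \<open>d\<close> fibres: the fibres
  \<open>j \<noteq> i\<close> in the clique part, all fibres of the opposite side in the bipartite
  part.\<close>

lemma card_lift_nbrs:
  assumes \<sigma>: "\<sigma> \<in> {1..d} \<rightarrow>\<^sub>E {p. p permutes {..<A}}"
    and \<pi>: "\<pi> \<in> {..<d} \<times> {..<d} \<rightarrow>\<^sub>E {p. p permutes {..<s}}"
    and v: "v \<in> lift_verts d A s"
  shows "card {w \<in> lift_verts d A s. lift_adj \<sigma> \<pi> v w} = d"
proof -
  obtain a i x where ax: "v = (a, i, x)" by (cases v)
  have pi: "\<pi> (i, j) permutes {..<s}" if "i < d" "j < d" for i j
    using \<pi> that by (auto simp: PiE_iff)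
  consider (0) "a = 0" "i \<le> d" "x < A" | (1) "a = 1" "i < d" "x < s" | (2) "a = 2" "i < d" "x < s"
    using v ax by (auto simp: lift_verts_def)
  then show ?thesis
  proof cases
    case 0
    let ?t = "\<lambda>j. inv (from_one \<sigma> j) (from_one \<sigma> i x)"
    note perm = from_one_permutes[OF \<sigma>]
    have eq: "from_one \<sigma> i x = from_one \<sigma> j y \<longleftrightarrow> y = ?t j" if "j \<le> d" for j y
      using permutes_inverses[OF perm[OF that]] by metis
    have mem: "?t j < A" if "j \<le> d" for j
      using permutes_in_image[OF perm[OF 0(2)]] permutes_in_image[OF permutes_inv[OF perm[OF that]]] 0(3) by simp
    have "{w \<in> lift_verts d A s. lift_adj \<sigma> \<pi> v w} = (\<lambda>j. (0::nat, j, ?t j)) ` ({..d} - {i})"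
    proof (intro equalityI subsetI)
      fix w assume w: "w \<in> {w \<in> lift_verts d A s. lift_adj \<sigma> \<pi> v w}"
      obtain b j y where "w = (b, j, y)" by (cases w)
      then show "w \<in> (\<lambda>j. (0::nat, j, ?t j)) ` ({..d} - {i})"
        using w 0 ax eq[of j y] by (auto simp: lift_verts_def)
    next
      fix w assume "w \<in> (\<lambda>j. (0::nat, j, ?t j)) ` ({..d} - {i})"
      then obtain j where "j \<le> d" "j \<noteq> i" "w = (0, j, ?t j)" by auto
      then show "w \<in> {w \<in> lift_verts d A s. lift_adj \<sigma> \<pi> v w}"
        using 0 ax eq[of j "?t j"] mem[of j] by (simp add: lift_verts_def)
    qed
    moreover have "card ((\<lambda>j. (0::nat, j, ?t j)) ` ({..d} - {i})) = card ({..d} - {i})"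
      by (rule card_image) (auto simp: inj_on_def)
    ultimately show ?thesis using 0(2) by simp
  next
    case 1
    have "{w \<in> lift_verts d A s. lift_adj \<sigma> \<pi> v w} = (\<lambda>j. (2::nat, j, \<pi> (i, j) x)) ` {..<d}"
    proof (intro equalityI subsetI)
      fix w assume w: "w \<in> {w \<in> lift_verts d A s. lift_adj \<sigma> \<pi> v w}"
      obtain b j y where "w = (b, j, y)" by (cases w)
      then show "w \<in> (\<lambda>j. (2::nat, j, \<pi> (i, j) x)) ` {..<d}"
        using w 1 ax by (auto simp: lift_verts_def)
    next
      fix w assume "w \<in> (\<lambda>j. (2::nat, j, \<pi> (i, j) x)) ` {..<d}"
      then obtain j where "j < d" "w = (2, j, \<pi> (i, j) x)" by auto
      then show "w \<in> {w \<in> lift_verts d A s. lift_adj \<sigma> \<pi> v w}"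
        using 1 ax permutes_in_image[OF pi[of i j], of x] by (simp add: lift_verts_def)
    qed
    moreover have "card ((\<lambda>j. (2::nat, j, \<pi> (i, j) x)) ` {..<d}) = card {..<d}"
      by (rule card_image) (auto simp: inj_on_def)
    ultimately show ?thesis by simp
  next
    case 2
    let ?t = "\<lambda>j. inv (\<pi> (j, i)) x"
    have eq: "\<pi> (j, i) y = x \<longleftrightarrow> y = ?t j" if "j < d" for j y
      using permutes_inverses[OF pi[OF that 2(2)]] by metis
    have mem: "?t j < s" if "j < d" for j
      using permutes_in_image[OF permutes_inv[OF pi[OF that 2(2)]]] 2(3) by simp
    have "{w \<in> lift_verts d A s. lift_adj \<sigma> \<pi> v w} = (\<lambda>j. (1::nat, j, ?t j)) ` {..<d}"
    proof (intro equalityI subsetI)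
      fix w assume w: "w \<in> {w \<in> lift_verts d A s. lift_adj \<sigma> \<pi> v w}"
      obtain b j y where "w = (b, j, y)" by (cases w)
      then show "w \<in> (\<lambda>j. (1::nat, j, ?t j)) ` {..<d}"
        using w 2 ax eq[of j y] by (auto simp: lift_verts_def)
    next
      fix w assume "w \<in> (\<lambda>j. (1::nat, j, ?t j)) ` {..<d}"
      then obtain j where "j < d" "w = (1, j, ?t j)" by auto
      then show "w \<in> {w \<in> lift_verts d A s. lift_adj \<sigma> \<pi> v w}"
        using 2 ax eq[of j "?t j"] mem[of j] by (simp add: lift_verts_def)
    qed
    moreover have "card ((\<lambda>j. (1::nat, j, ?t j)) ` {..<d}) = card {..<d}"
      by (rule card_image) (auto simp: inj_on_def)
    ultimately show ?thesis by simp
  qed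
qed

text \<open>The neighbour of \<open>(0, i, x)\<close> in fibre \<open>0\<close> reveals
  \<open>\<sigma> i x\<close>, and each matching is read off its edges; outside their ranges the
  permutations fix everything.\<close>

lemma lift_adj_inj:
  assumes \<sigma>: "\<sigma> \<in> {1..d} \<rightarrow>\<^sub>E {p. p permutes {..<A}}" "\<sigma>' \<in> {1..d} \<rightarrow>\<^sub>E {p. p permutes {..<A}}"
    and \<pi>: "\<pi> \<in> {..<d} \<times> {..<d} \<rightarrow>\<^sub>E {p. p permutes {..<s}}" "\<pi>' \<in> {..<d} \<times> {..<d} \<rightarrow>\<^sub>E {p. p permutes {..<s}}"
    and eq: "\<And>v w. v \<in> lift_verts d A s \<Longrightarrow> w \<in> lift_verts d A s \<Longrightarrow> lift_adj \<sigma> \<pi> v w \<longleftrightarrow> lift_adj \<sigma>' \<pi>' v w"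
  shows "\<sigma> = \<sigma>'" "\<pi> = \<pi>'"
proof -
  show "\<sigma> = \<sigma>'"
  proof (rule PiE_ext[OF \<sigma>], rule ext)
    fix i x assume i: "i \<in> {1..d}"
    then have p: "\<sigma> i permutes {..<A}" "\<sigma>' i permutes {..<A}" using \<sigma> by (auto simp: PiE_iff)
    show "\<sigma> i x = \<sigma>' i x"
    proof (cases "x < A")
      case True
      then have "\<sigma> i x < A" using permutes_in_image[OF p(1), of x] by simp
      then show ?thesis
        using eq[of "(0, i, x)" "(0, 0, \<sigma> i x)"] True i by (simp add: lift_verts_def from_one_def)
    qed (use p in \<open>simp add: permutes_not_in\<close>)
  qed
  show "\<pi> = \<pi>'"
  proof (rule PiE_ext[OF \<pi>], rule ext)
    fix ij x assume ij: "ij \<in> {..<d} \<times> {..<d}"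
    then have p: "\<pi> ij permutes {..<s}" "\<pi>' ij permutes {..<s}" using \<pi> by (auto simp: PiE_iff)
    obtain i j where ij': "ij = (i, j)" "i < d" "j < d" using ij by auto
    show "\<pi> ij x = \<pi>' ij x"
    proof (cases "x < s")
      case True
      then have "\<pi> ij x < s" using permutes_in_image[OF p(1), of x] by simp
      then show ?thesis
        using eq[of "(1, i, x)" "(2, j, \<pi> ij x)"] True ij' by (simp add: lift_verts_def)
    qed (use p in \<open>simp add: permutes_not_in\<close>)
  qed
qed

section \<open>The number of lifts\<close>

lemma finite_Gdck: "finite (Gdck d c k n)"
  by (rule finite_subset[of _ "Pow (Pow {..<n})"])
    (auto simp: Gdck_def regular_graph_def simple_graph_def)

text \<open>Distinct lifts give distinct graphs under one fixed labelling. The \<open>A\<close>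
  cliques alone contain \<open>A * ((d + 1) choose k)\<close> copies of \<open>K_k\<close>, and
  absorption turns the density requirement into \<open>c * n \<le> (d + 1) * A\<close>.\<close>

lemma card_Gdck_ge:
  assumes n: "n = (d + 1) * A + 2 * d * s" and k: "k \<ge> 1"
    and A: "c * real n \<le> real (d + 1) * real A"
  shows "fact A ^ d * fact s ^ (d * d) \<le> card (Gdck d c k n)"
proof -
  let ?V = "lift_verts d A s"
  define S where "S = {1..d} \<rightarrow>\<^sub>E {p. p permutes {..<A}}"
  define T where "T = {..<d} \<times> {..<d} \<rightarrow>\<^sub>E {p. p permutes {..<s}}"
  have "card ?V = card {..<n}" by (simp add: card_lift_verts n)
  then obtain f where f: "bij_betw f ?V {..<n}"
    using finite_same_card_bij[OF finite_lift_verts finite_lessThan] by blast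
  then have inj: "inj_on f ?V" and img: "f ` ?V = {..<n}" by (auto simp: bij_betw_def)
  define g where "g = (\<lambda>(\<sigma>, \<pi>). relabel f ?V (lift_adj \<sigma> \<pi>))"
  have g_iff: "{f v, f w} \<in> g (\<sigma>, \<pi>) \<longleftrightarrow> lift_adj \<sigma> \<pi> v w" if "v \<in> ?V" "w \<in> ?V" for v w \<sigma> \<pi>
    using relabel_iff[OF inj symp_lift_adj that] by (simp add: g_def)
  have "card (S \<times> T) \<le> card (Gdck d c k n)"
  proof (rule card_inj_on_le[where f = g])
    show "inj_on g (S \<times> T)"
    proof (rule inj_onI)
      fix st st' assume *: "st \<in> S \<times> T" "st' \<in> S \<times> T" "g st = g st'"
      obtain \<sigma> \<pi> \<sigma>' \<pi>' where st: "st = (\<sigma>, \<pi>)" "st' = (\<sigma>', \<pi>')" by (cases st, cases st')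
      have mem: "\<sigma> \<in> S" "\<sigma>' \<in> S" "\<pi> \<in> T" "\<pi>' \<in> T" using * st by auto
      have "lift_adj \<sigma> \<pi> v w \<longleftrightarrow> lift_adj \<sigma>' \<pi>' v w" if "v \<in> ?V" "w \<in> ?V" for v w
        using g_iff[OF that, of \<sigma> \<pi>] g_iff[OF that, of \<sigma>' \<pi>'] *(3) by (simp add: st)
      note lift_adj_inj[OF mem[unfolded S_def T_def] this]
      then show "st = st'" by (simp add: st)
    qed
    show "g ` (S \<times> T) \<subseteq> Gdck d c k n"
    proof clarify
      fix \<sigma> \<pi> assume \<sigma>: "\<sigma> \<in> S" and \<pi>: "\<pi> \<in> T"
      have reg: "regular_graph n d (g (\<sigma>, \<pi>))"
        unfolding g_def prod.case
        by (intro regular_graph_relabel f symp_lift_adj irreflp_lift_adj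
            card_lift_nbrs[OF \<sigma>[unfolded S_def] \<pi>[unfolded T_def]])
      note perm = from_one_permutes[OF \<sigma>[unfolded S_def]]
      let ?t = "\<lambda>j i. inv (from_one \<sigma> i) j"
      define K where "K j = (\<lambda>i. (0::nat, i, ?t j i)) ` {..d}" for j
      have KV: "K j \<subseteq> ?V" if "j < A" for j
        using permutes_in_image[OF permutes_inv[OF perm]] that by (auto simp: K_def lift_verts_def)
      have Kt: "from_one \<sigma> i (?t j i) = j" if "i \<le> d" for i j
        using permutes_inverses(1)[OF perm[OF that]] .
      have "A * ((d + 1) choose k) \<le> card (cliques n k (g (\<sigma>, \<pi>)))"
      proof (rule card_cliques_disjoint_ge[OF k, where K = "\<lambda>j. f ` K j"])
        fix j assume j: "j < A"
        have "card (K j) = d + 1" unfolding K_def by (subst card_image) (auto simp: inj_on_def)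
        moreover have "inj_on f (K j)" using inj KV[OF j] by (rule inj_on_subset)
        moreover have "f ` K j \<subseteq> {..<n}" using KV[OF j] img by blast
        moreover have "is_clique (g (\<sigma>, \<pi>)) (f ` K j)"
          unfolding is_clique_def
        proof (intro ballI impI)
          fix u v assume uv: "u \<in> f ` K j" "v \<in> f ` K j" "u \<noteq> v"
          then obtain a b where ab: "a \<in> K j" "b \<in> K j" "u = f a" "v = f b" "a \<noteq> b" by blast
          then have "lift_adj \<sigma> \<pi> a b" using Kt by (auto simp: K_def)
          moreover have "a \<in> ?V" "b \<in> ?V" using ab(1,2) KV[OF j] by blast+
          ultimately show "{u, v} \<in> g (\<sigma>, \<pi>)" using g_iff[of a b \<sigma> \<pi>] ab(3,4) by simp
        qed
        ultimately show "f ` K j \<in> cliques n (d + 1) (g (\<sigma>, \<pi>))"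
          by (simp add: cliques_def card_image)
      next
        fix i j assume ij: "i < A" "j < A" "i \<noteq> j"
        \<comment> \<open>Each vertex determines the number of its clique, so cliques with different
          numbers are disjoint.\<close>
        have "from_one \<sigma> (fst (snd a)) (snd (snd a)) = l" if "a \<in> K l" for a l
          using that Kt by (auto simp: K_def)
        then have "K i \<inter> K j = {}" using ij(3) by blast
        then show "f ` K i \<inter> f ` K j = {}"
          using inj_on_image_Int[OF inj KV[OF ij(1)] KV[OF ij(2)]] by simp
      qed
      then have cl: "real A * real ((d + 1) choose k) \<le> real (card (cliques n k (g (\<sigma>, \<pi>))))"
        by (simp only: of_nat_le_iff flip: of_nat_mult)
      have "k * ((d + 1) choose k) = (d + 1) * (d choose (k - 1))"
        using binomial_absorption[of "k - 1" "d + 1"] k by simp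
      then have abs: "real k * real ((d + 1) choose k) = real (d + 1) * real (d choose (k - 1))"
        by (metis of_nat_mult)
      have "c * real (d choose (k - 1)) * real n = (c * real n) * real (d choose (k - 1))" by simp
      also have "\<dots> \<le> real (d + 1) * real A * real (d choose (k - 1))"
        by (intro mult_right_mono A) simp
      also have "\<dots> = real A * (real k * real ((d + 1) choose k))" unfolding abs by simp
      finally have "c * real (d choose (k - 1)) * real n / real k \<le> real A * real ((d + 1) choose k)"
        using k by (simp add: pos_divide_le_eq mult_ac)
      then show "g (\<sigma>, \<pi>) \<in> Gdck d c k n" using reg cl by (simp add: Gdck_def)
    qed
  qed (rule finite_Gdck)
  moreover have "card S = fact A ^ d" "card T = fact s ^ (d * d)"
    unfolding S_def T_def by (simp_all add: card_PiE card_permutations)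
  ultimately show ?thesis by (simp add: card_cartesian_product)
qed

section \<open>Asymptotics\<close>

text \<open>The remainder \<open>n - (d + 1) * A\<close> must be divisible by \<open>2 * d\<close>.
  Taking \<open>A\<close> congruent to \<open>n * (d + 1)\<close> works: the remainder is then
  congruent to \<open>- d * (d + 2) * n\<close>, and \<open>n * (d + 2)\<close> is even. The shift
  \<open>r\<close> moves \<open>a\<close> up into this residue class.\<close>

lemma exists_decomposition:
  fixes n d a :: nat
  assumes "d \<ge> 1" "even (n * d)" "(d + 1) * (a + 2 * d) \<le> n"
  obtains A s where "n = (d + 1) * A + 2 * d * s" "a \<le> A" "A < a + 2 * d"
proof -
  define r where "r = (int n * (int d + 1) - int a) mod (2 * int d)"
  have r: "0 \<le> r" "r < 2 * int d" using assms(1) by (simp_all add: r_def)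
  define A where "A = a + nat r"
  have A: "a \<le> A" "A < a + 2 * d" using r by (auto simp: A_def)
  obtain q where "int n * (int d + 1) - int a = 2 * int d * q + r"
    unfolding r_def by (metis mult_div_mod_eq)
  then have q: "int A = int n * (int d + 1) - 2 * int d * q" using r(1) by (simp add: A_def)
  have "even (n * (d + 2))" using assms(2) by auto
  then obtain m where "n * (d + 2) = 2 * m" by blast
  then have m: "int n * (int d + 2) = 2 * int m" by (metis of_nat_add of_nat_mult of_nat_numeral)
  have "int n - (int d + 1) * int A = - int d * (int n * (int d + 2)) + 2 * int d * ((int d + 1) * q)"
    unfolding q by (simp add: algebra_simps)
  also have "\<dots> = 2 * int d * ((int d + 1) * q - int m)" unfolding m by (simp add: algebra_simps)
  finally have "2 * int d dvd int n - (int d + 1) * int A" by simp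
  moreover have le: "(d + 1) * A \<le> n"
    using mult_left_mono[of A "a + 2 * d" "d + 1"] A(2) assms(3) by linarith
  then have "int n - (int d + 1) * int A = int (n - (d + 1) * A)" by (simp only: of_nat_diff of_nat_mult of_nat_add of_nat_1)
  ultimately have "2 * d dvd n - (d + 1) * A" by (metis of_nat_dvd_iff of_nat_mult of_nat_numeral)
  then obtain s where "n - (d + 1) * A = 2 * d * s" by blast
  then have "n = (d + 1) * A + 2 * d * s" using le by linarith
  then show thesis using that A by blast
qed

text \<open>\<open>m ^ m / m!\<close> is one term of the series of \<open>exp m\<close>.\<close>

lemma fact_ge_exp: "exp (real m * (ln (real m) - 1)) \<le> fact m"
proof (cases "m = 0")
  case False
  have "real m ^ m / fact m \<le> (\<Sum>i\<in>{..m}. real m ^ i / fact i)"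
    by (rule member_le_sum) auto
  also have "\<dots> \<le> exp (real m)" by (rule sum_power_div_fact_le_exp) simp
  finally have "real m ^ m \<le> exp (real m) * fact m" by (simp add: pos_divide_le_eq)
  moreover have "real m ^ m = exp (real m * ln (real m))" using False by (simp add: exp_of_nat_mult)
  ultimately show ?thesis by (simp add: right_diff_distrib exp_diff pos_divide_le_eq mult.commute)
qed simp

text \<open>With \<open>A\<close> close to \<open>c * n / (d + 1)\<close>, the number of lifts has
  logarithm about \<open>(d * A + d^2 * s) * ln n\<close>, which is the main term. Rounding of
  \<open>A\<close> and the passage from \<open>ln A\<close> and \<open>ln s\<close> to
  \<open>ln n\<close> cost multiples of \<open>n * d * ln d\<close>.\<close>

lemma card_Gdck_ge_exp:
  assumes c: "0 < c" "c < 1" and k: "k \<ge> 1" and d: "d \<ge> 2" "d ^ 4 \<le> n"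
    and n: "64 / (1 - c) ^ 2 \<le> real n" "even (n * d)"
  shows "exp (real d / 2 * real n * (1 - c * ((real d - 1) / (real d + 1))) * ln (real n)
      - (6 - ln c - ln ((1 - c) / 4)) * real n * real d * ln (real d)) \<le> real (card (Gdck d c k n))"
proof -
  have n1: "real n \<ge> 1"
  proof -
    have "0 < d ^ 4" using d(1) by simp
    then have "n \<ge> 1" using d(2) by linarith
    then show ?thesis by simp
  qed
  have d2: "real d \<ge> 2" using d(1) by simp
  define L where "L = ln (real n)"
  define l where "l = ln (real d)"
  have L0: "L \<ge> 0" using n1 by (simp add: L_def)
  have l1: "1 \<le> 2 * l" using one_le_twice_ln[OF d2] by (simp add: l_def)
  have "real (d ^ 4) \<le> real n" using d(2) by (simp only: of_nat_le_iff)
  then have d4: "(real d ^ 2) ^ 2 \<le> real n" by (simp add: power_mult[symmetric])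
  then have dsq: "real d ^ 2 \<le> sqrt (real n)" by (rule real_le_rsqrt)
  \<comment> \<open>Rounding can cost \<open>(d + 1) * (2 * d + 1)\<close> vertices. By
    \<open>d ^ 4 \<le> n\<close> this is at most \<open>4 * sqrt n\<close>, and the lower bound on
    \<open>n\<close> makes that at most half of \<open>(1 - c) * n\<close>, leaving the other half
    for the bipartite part.\<close>
  have small: "(real d + 1) * (2 * real d + 1) \<le> (1 - c) / 2 * real n"
  proof -
    have "(real d + 1) * (2 * real d + 1) = 4 * real d ^ 2 - (real d * (real d - 2) + (real d * (real d - 2) + (real d - 1)))"
      by (simp add: algebra_simps power2_eq_square)
    also have "\<dots> \<le> 4 * real d ^ 2"
    proof -
      have "0 \<le> real d * (real d - 2)" using d2 by simp
      then show ?thesis using d2 by linarith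
    qed
    also have "\<dots> \<le> 4 * sqrt (real n)" using dsq by simp
    also have "\<dots> \<le> (1 - c) / 2 * real n"
    proof -
      have "64 \<le> real n * (1 - c) ^ 2" using n(1) c by (simp add: pos_divide_le_eq)
      then have "64 \<le> (sqrt (real n) * (1 - c)) ^ 2" by (simp add: power_mult_distrib)
      then have "(8::real) ^ 2 \<le> (sqrt (real n) * (1 - c)) ^ 2" by simp
      then have "8 \<le> sqrt (real n) * (1 - c)" by (rule power2_le_imp_le) (use c in simp)
      then have "8 * sqrt (real n) \<le> sqrt (real n) * (1 - c) * sqrt (real n)"
        by (intro mult_right_mono) auto
      also have "\<dots> = (1 - c) * (sqrt (real n) * sqrt (real n))" by (simp only: mult_ac)
      also have "\<dots> = (1 - c) * real n" by simp
      finally show ?thesis by simp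
    qed
    finally show ?thesis .
  qed
  define a where "a = nat \<lceil>c * real n / (real d + 1)\<rceil>"
  have "c * real n / (real d + 1) \<ge> 0" using c by simp
  then have a: "c * real n / (real d + 1) \<le> real a" "real a \<le> c * real n / (real d + 1) + 1"
    unfolding a_def by linarith+
  have "(real d + 1) * (real a + 2 * real d) \<le> (real d + 1) * (c * real n / (real d + 1) + 1 + 2 * real d)"
    using a(2) by (intro mult_left_mono) auto
  also have "\<dots> = c * real n + (real d + 1) * (2 * real d + 1)"
    using d2 by (simp add: field_simps)
  also have "\<dots> \<le> real n"
  proof -
    have "(1 - c) / 2 * real n \<le> (1 - c) * real n" using c by (intro mult_right_mono) auto
    then show ?thesis using small by (simp add: left_diff_distrib)
  qed
  finally have "real ((d + 1) * (a + 2 * d)) \<le> real n" by (simp add: algebra_simps)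
  then have "(d + 1) * (a + 2 * d) \<le> n" by (simp only: of_nat_le_iff)
  then obtain A s where As: "n = (d + 1) * A + 2 * d * s" "a \<le> A" "A < a + 2 * d"
    using exists_decomposition[of d n a] d(1) n(2) by auto
  have nAs: "real n = (real d + 1) * real A + 2 * real d * real s"
    by (subst As(1)) (simp add: algebra_simps)
  have A1: "c * real n / (real d + 1) \<le> real A" using a(1) As(2) by linarith
  have A2: "real A \<le> c * real n / (real d + 1) + 1 + 2 * real d" using a(2) As(3) by linarith
  have s1: "(1 - c) / 4 * real n / real d \<le> real s"
  proof -
    have "(real d + 1) * real A \<le> (real d + 1) * (c * real n / (real d + 1) + 1 + 2 * real d)"
      using A2 by (intro mult_left_mono) auto
    also have "\<dots> = c * real n + (real d + 1) * (2 * real d + 1)"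
      using d2 by (simp add: field_simps)
    moreover have e: "(1 - c) / 2 * real n = real n / 2 - c * real n / 2" by (simp add: field_simps)
    ultimately have "(1 - c) / 2 * real n \<le> 2 * real d * real s"
      using small nAs unfolding e by linarith
    then show ?thesis using d2 by (simp add: pos_divide_le_eq mult_ac)
  qed
  have lnA: "L + ln c - 2 * l \<le> ln (real A)"
  proof -
    have "real d + 1 \<le> real d * real d"
      using mult_right_mono[of 2 "real d" "real d"] d2 by linarith
    then have "ln (real d + 1) \<le> ln (real d * real d)" using d2 by (subst ln_le_cancel_iff) auto
    also have "\<dots> = 2 * l" using d2 by (simp add: ln_mult l_def)
    finally have "L + ln c - 2 * l \<le> ln (c * real n / (real d + 1))"
      using c n1 d2 by (simp add: ln_div ln_mult L_def)
    also have "\<dots> \<le> ln (real A)"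
      using A1 c n1 by (intro ln_mono) auto
    finally show ?thesis .
  qed
  have lns: "L + ln ((1 - c) / 4) - l \<le> ln (real s)"
  proof -
    have "L + ln ((1 - c) / 4) - l = ln ((1 - c) / 4 * real n / real d)"
      using c n1 d2 by (simp add: ln_div ln_mult L_def l_def)
    also have "\<dots> \<le> ln (real s)" using s1 c n1 d2 by (intro ln_mono) auto
    finally show ?thesis .
  qed
  define K where "K = - ln c - ln ((1 - c) / 4)"
  have lnc: "ln c \<le> 0" "ln ((1 - c) / 4) \<le> 0" using c by auto
  then have K0: "K \<ge> 0" by (simp add: K_def)
  \<comment> \<open>\<open>?W\<close> counts the logarithmic factors of
    \<open>A!^d * s!^(d*d)\<close>. Eliminating \<open>s\<close> shows that one more clique lowers
    it by \<open>d * (d - 1) / 2\<close>, so the upper bound on \<open>A\<close> yields the main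
    term.\<close>
  let ?W = "real d * real A + real d * real d * real s"
  have W: "?W = real d * real n / 2 - real d * (real d - 1) / 2 * real A"
    unfolding nAs by (simp add: field_simps)
  have W_le: "?W \<le> real d * real n / 2" unfolding W using d2 by simp
  have W_ge: "real d / 2 * real n * (1 - c * ((real d - 1) / (real d + 1)))
      - real d * (real d - 1) / 2 * (1 + 2 * real d) \<le> ?W"
  proof -
    have "real d * (real d - 1) / 2 * real A
        \<le> real d * (real d - 1) / 2 * (c * real n / (real d + 1) + 1 + 2 * real d)"
      using A2 d2 by (intro mult_left_mono) auto
    also have "\<dots> = real d / 2 * real n * (c * ((real d - 1) / (real d + 1)))
        + real d * (real d - 1) / 2 * (1 + 2 * real d)"
      by (simp add: distrib_left)
    finally have "real d * (real d - 1) / 2 * real A \<le> real d / 2 * real n * (c * ((real d - 1) / (real d + 1)))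
        + real d * (real d - 1) / 2 * (1 + 2 * real d)" .
    moreover have "real d / 2 * real n * (1 - c * ((real d - 1) / (real d + 1)))
        = real d * real n / 2 - real d / 2 * real n * (c * ((real d - 1) / (real d + 1)))"
      by (simp add: right_diff_distrib)
    ultimately show ?thesis unfolding W by linarith
  qed
  \<comment> \<open>The rounding loss times \<open>ln n\<close>: it is reduced to
    \<open>O(n * d)\<close> by \<open>ln n \<le> 2 * sqrt n\<close> and
    \<open>d^2 \<le> sqrt n\<close>.\<close>
  have defect: "real d * (real d - 1) / 2 * (1 + 2 * real d) * L \<le> 2 * (real n * real d)"
  proof -
    have "L = 2 * ln (sqrt (real n))" using n1 by (simp add: ln_sqrt L_def)
    also have "\<dots> \<le> 2 * sqrt (real n)" using n1 ln_bound[of "sqrt (real n)"] by simp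
    finally have "real d ^ 2 * L \<le> sqrt (real n) * (2 * sqrt (real n))"
      using dsq L0 by (intro mult_mono) auto
    also have "\<dots> = 2 * (sqrt (real n) * sqrt (real n))" by (simp only: mult_ac)
    finally have *: "real d ^ 2 * L \<le> 2 * real n" by simp
    have "real d * (real d - 1) / 2 * (1 + 2 * real d) * L \<le> real d * (real d ^ 2) * L"
    proof (rule mult_right_mono[OF _ L0])
      have "real d * (real d - 1) / 2 * (1 + 2 * real d) = real d * (real d ^ 2) - real d * (real d + 1) / 2"
        by (simp add: field_simps power2_eq_square)
      then show "real d * (real d - 1) / 2 * (1 + 2 * real d) \<le> real d * (real d ^ 2)" by simp
    qed
    also have "\<dots> = real d * (real d ^ 2 * L)" by simp
    also have "\<dots> \<le> real d * (2 * real n)" using * by (intro mult_left_mono) auto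
    finally show ?thesis by (simp add: mult_ac)
  qed
  have "real d / 2 * real n * (1 - c * ((real d - 1) / (real d + 1))) * L - (6 + K) * real n * real d * l
      \<le> ?W * (L - (K + 2 * l + 1))"
  proof -
    have "(real d / 2 * real n * (1 - c * ((real d - 1) / (real d + 1)))
      - real d * (real d - 1) / 2 * (1 + 2 * real d)) * L \<le> ?W * L"
      using W_ge L0 by (rule mult_right_mono)
    then have 1: "real d / 2 * real n * (1 - c * ((real d - 1) / (real d + 1))) * L - 2 * (real n * real d) \<le> ?W * L"
      using defect by (simp only: left_diff_distrib)
    have 2: "?W * (K + 2 * l + 1) \<le> (real n * real d) * ((K + 2 * l + 1) / 2)"
      using mult_right_mono[OF W_le, of "K + 2 * l + 1"] K0 l1 by (simp add: mult_ac)
    have "K * 1 \<le> K * (2 * l)" using K0 l1 by (intro mult_left_mono) auto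
    then have "K \<le> 2 * (K * l)" by (simp add: mult_ac)
    \<comment> \<open>Origin of the \<open>6\<close>: half of \<open>2 * l\<close> is
      \<open>l\<close>, and the constants \<open>1/2 + 2\<close> are at most \<open>5 * l\<close>
      since \<open>1 \<le> 2 * l\<close>.\<close>
    then have "(K + 2 * l + 1) / 2 + 2 \<le> (6 + K) * l"
      using l1 by (simp add: field_simps)
    then have "(real n * real d) * ((K + 2 * l + 1) / 2 + 2) \<le> (real n * real d) * ((6 + K) * l)"
      by (intro mult_left_mono) auto
    then have 3: "(real n * real d) * ((K + 2 * l + 1) / 2) + 2 * (real n * real d) \<le> (6 + K) * real n * real d * l"
      by (simp only: distrib_left mult_ac)
    show ?thesis using 1 2 3 by (simp only: right_diff_distrib)
  qed
  also have "\<dots> \<le> real d * (real A * (ln (real A) - 1)) + real d * real d * (real s * (ln (real s) - 1))"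
  proof -
    have "L - (K + 2 * l + 1) \<le> ln (real A) - 1" "L - (K + 2 * l + 1) \<le> ln (real s) - 1"
      using lnA lns lnc l1 by (simp_all add: K_def)
    then have "real d * real A * (L - (K + 2 * l + 1)) \<le> real d * real A * (ln (real A) - 1)"
      "real d * real d * real s * (L - (K + 2 * l + 1)) \<le> real d * real d * real s * (ln (real s) - 1)"
      by (intro mult_left_mono; simp)+
    then show ?thesis by (simp add: distrib_right mult.assoc)
  qed
  finally have "exp (real d / 2 * real n * (1 - c * ((real d - 1) / (real d + 1))) * L - (6 + K) * real n * real d * l)
     \<le> exp (real d * (real A * (ln (real A) - 1)) + real d * real d * (real s * (ln (real s) - 1)))"
    by (simp only: exp_le_cancel_iff)
  also have "\<dots> = exp (real A * (ln (real A) - 1)) ^ d * exp (real s * (ln (real s) - 1)) ^ (d * d)"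
    by (simp add: exp_add flip: exp_of_nat_mult)
  also have "\<dots> \<le> fact A ^ d * fact s ^ (d * d)"
    by (intro mult_mono power_mono fact_ge_exp) auto
  also have "\<dots> = real (fact A ^ d * fact s ^ (d * d))" by simp
  also have "\<dots> \<le> real (card (Gdck d c k n))"
  proof -
    have "c * real n \<le> real (d + 1) * real A" using A1 by (simp add: pos_divide_le_eq mult.commute add.commute)
    from card_Gdck_ge[OF As(1) k this] show ?thesis by (simp only: of_nat_le_iff)
  qed
  finally show ?thesis by (simp add: L_def l_def K_def algebra_simps)
qed

text \<open>The parameter \<open>b\<close> serves two uses: \<open>b = 0\<close> for the whole
  class, and \<open>b = \<epsilon> * n\<close> for graphs with many bad nodes, whose bound is
  smaller by the factor \<open>n ^ (b / (2 * (d + 1) ^ 2))\<close>.\<close>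

lemma card_Gdck_le_exp:
  assumes "k \<ge> 3" "d \<ge> k - 1" "n \<ge> 1"
    and G: "G \<subseteq> Gdck d c k n" "\<And>E. E \<in> G \<Longrightarrow> b \<le> real (card (bad_nodes n d k E))"
  shows "real (card G) \<le> exp ((real d / 2 * real n * (1 - c * ((real d - 1) / (real d + 1)))
      - b / (2 * (real d + 1) ^ 2)) * ln (real n) + 4 * real n * real d * ln (real d))"
proof (rule card_regular_graphs_le)
  show "G \<subseteq> {E. regular_graph n d E}" using G(1) by (auto simp: Gdck_def)
  fix E assume E: "E \<in> G"
  have "b / (2 * (real d + 1) ^ 2) \<le> real (card (bad_nodes n d k E)) / (2 * (real d + 1) ^ 2)"
    using G(2)[OF E] by (intro divide_right_mono) auto
  then show "(\<Sum>e\<in>E. 2 / (real (card (common E e)) + 2))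
      \<le> real d / 2 * real n * (1 - c * ((real d - 1) / (real d + 1))) - b / (2 * (real d + 1) ^ 2)"
    using cost_le[of E d c k n] E G(1) assms(1,2) by fastforce
qed (use assms in auto)

section \<open>Degenerate cases and the final estimates\<close>

lemma Gdck_empty:
  assumes "odd (n * d)"
  shows "Gdck d c k n = {}"
proof -
  have "\<not> regular_graph n d E" for E using handshake[of n d E] assms by (metis dvd_triv_left)
  then show ?thesis by (simp add: Gdck_def)
qed

lemma bad_nodes_empty:
  assumes "regular_graph n d E" "d < k - 1"
  shows "bad_nodes n d k E = {}"
proof (rule ccontr)
  assume "bad_nodes n d k E \<noteq> {}"
  then obtain v S where S: "S \<in> cliques n k E" "v \<in> S" "v < n" by (auto simp: bad_nodes_def)
  have fS: "finite S" "card S = k" using S(1) by (auto simp: cliques_def intro: finite_subset)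
  have "S - {v} \<subseteq> nbrs E v" using S by (auto simp: cliques_def is_clique_def nbrs_def)
  from card_mono[OF regular_graphD(3)[OF assms(1)] this] show False
    using fS S(2) assms(2) regular_graphD(2)[OF assms(1) S(3)] by simp
qed

text \<open>The counting bounds give the upper estimate, and the lower one if
  \<open>d ^ 4 \<le> n\<close>. For larger \<open>d\<close>, \<open>ln n \<le> 4 * ln d\<close>
  makes the main term itself no larger than the allowed error. The factor \<open>2\<close> comes
  from dividing \<open>n * d * ln d\<close> by \<open>(d / 2) * n * ln n\<close>.\<close>

lemma abs_ln_card_Gdck_le:
  assumes c: "0 < c" "c < 1" and k: "k \<ge> 3" "d \<ge> k - 1"
    and n: "64 / (1 - c) ^ 2 \<le> real n" "n \<ge> 2" "even (n * d)"
  shows "\<bar>ln (real (card (Gdck d c k n))) / (real d / 2 * real n * ln (real n))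
               - (1 - c * ((real d - 1) / (real d + 1)))\<bar>
     \<le> 2 * (6 - ln c - ln ((1 - c) / 4)) * (ln (real d) / ln (real n))"
proof -
  define Y where "Y = 1 - c * ((real d - 1) / (real d + 1))"
  define D where "D = real d / 2 * real n * ln (real n)"
  define R where "R = real n * real d * ln (real d)"
  define C where "C = 6 - ln c - ln ((1 - c) / 4)"
  define g where "g = real (card (Gdck d c k n))"
  have d2: "d \<ge> 2" using k by linarith
  have lnc: "ln c \<le> 0" "ln ((1 - c) / 4) \<le> 0" using c by auto
  then have C: "C \<ge> 6" by (simp add: C_def)
  have D0: "D > 0" using d2 n(2) by (simp add: D_def)
  have R0: "R \<ge> 0" using d2 by (simp add: R_def)
  have "c * ((real d - 1) / (real d + 1)) \<le> 1 * 1"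
    using c d2 by (intro mult_mono) auto
  moreover have "c * ((real d - 1) / (real d + 1)) \<ge> 0" using c d2 by simp
  ultimately have Y: "0 \<le> Y" "Y \<le> 1" by (auto simp: Y_def)
  \<comment> \<open>An empty class has \<open>ln 0 = 0\<close> by convention, so the logarithm is
    nonnegative in every case.\<close>
  have "g = 0 \<or> g \<ge> 1" by (simp add: g_def) linarith
  then have g: "ln g \<ge> 0" by auto
  have "g \<le> exp (D * Y + 4 * R)"
    using card_Gdck_le_exp[of k d n "Gdck d c k n" c 0] k n(2) by (simp add: g_def D_def Y_def R_def mult_ac)
  then have "g \<ge> 1 \<Longrightarrow> ln g \<le> D * Y + 4 * R"
    using ln_mono[of g "exp (D * Y + 4 * R)"] by simp
  then have "ln g \<le> D * Y + 4 * R"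
    using \<open>g = 0 \<or> g \<ge> 1\<close> D0 R0 Y by auto
  moreover have "4 * R \<le> C * R" using C R0 by (intro mult_right_mono) auto
  ultimately have up: "ln g - D * Y \<le> C * R" by linarith
  have low: "D * Y - ln g \<le> C * R"
  proof (cases "d ^ 4 \<le> n")
    case True
    have "exp (D * Y - C * R) \<le> g"
      using card_Gdck_ge_exp[OF c _ d2 True n(1,3), of k] k(1)
      by (simp add: g_def D_def Y_def R_def C_def mult_ac)
    moreover have "g > 0" using calculation exp_gt_zero less_le_trans by blast
    ultimately have "D * Y - C * R \<le> ln g" by (simp add: ln_ge_iff)
    then show ?thesis by linarith
  next
    case False
    then have "real n \<le> real (d ^ 4)" by (simp only: of_nat_le_iff)
    then have "ln (real n) \<le> ln (real d ^ 4)" using n(2) d2 by (subst ln_le_cancel_iff) auto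
    then have "ln (real n) \<le> 4 * ln (real d)" using d2 by (simp add: ln_realpow)
    then have "D \<le> real d / 2 * real n * (4 * ln (real d))" unfolding D_def by (intro mult_left_mono) auto
    then have "D \<le> 2 * R" by (simp add: R_def mult_ac)
    moreover have "D * Y \<le> D * 1" using D0 Y by (intro mult_left_mono) auto
    moreover have "2 * R \<le> C * R" using C R0 by (intro mult_right_mono) auto
    ultimately show ?thesis using g by linarith
  qed
  have "ln g / D - Y = (ln g - D * Y) / D" using D0 by (simp add: field_simps)
  then have "\<bar>ln g / D - Y\<bar> = \<bar>ln g - D * Y\<bar> / D" using D0 by simp
  also have "\<dots> \<le> C * R / D" using up low D0 by (intro divide_right_mono) auto
  also have "\<dots> = 2 * C * (ln (real d) / ln (real n))"
    using d2 n(2) by (simp add: R_def D_def)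
  finally show ?thesis by (simp add: g_def D_def Y_def C_def)
qed

text \<open>Divide the upper bound for graphs with many bad nodes by the lower bound for the whole
  class: the main terms cancel, and the error constants \<open>4\<close> and \<open>6\<close> add up
  to \<open>10\<close>. For odd \<open>n * d\<close> the class is empty and the quotient is
  \<open>0\<close>.\<close>

lemma bad_proportion_le:
  assumes c: "0 < c" "c < 1" and k: "k \<ge> 3" "d \<ge> k - 1"
    and n: "64 / (1 - c) ^ 2 \<le> real n" "d ^ 4 \<le> n" "n \<ge> 1"
  shows "real (card {E \<in> Gdck d c k n. real (card (bad_nodes n d k E)) > \<epsilon> * real n})
           / real (card (Gdck d c k n))
     \<le> exp ((10 - ln c - ln ((1 - c) / 4)) * real d * ln (real d) * real n
           - \<epsilon> / (2 * (real d + 1) ^ 2) * real n * ln (real n))"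
proof (cases "even (n * d)")
  case True
  let ?B = "{E \<in> Gdck d c k n. real (card (bad_nodes n d k E)) > \<epsilon> * real n}"
  define X where "X = real d / 2 * real n * (1 - c * ((real d - 1) / (real d + 1))) * ln (real n)"
  define R where "R = real n * real d * ln (real d)"
  define C where "C = 6 - ln c - ln ((1 - c) / 4)"
  define q where "q = \<epsilon> / (2 * (real d + 1) ^ 2) * real n * ln (real n)"
  have "real (card ?B) \<le> exp ((real d / 2 * real n * (1 - c * ((real d - 1) / (real d + 1)))
      - \<epsilon> * real n / (2 * (real d + 1) ^ 2)) * ln (real n) + 4 * real n * real d * ln (real d))"
    by (rule card_Gdck_le_exp[OF k n(3)]) auto
  also have "\<dots> = exp (X - q + 4 * R)"
    by (simp add: X_def q_def R_def left_diff_distrib)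
  finally have "real (card ?B) \<le> exp (X - q + 4 * R)" .
  moreover have low: "exp (X - C * R) \<le> real (card (Gdck d c k n))"
    using card_Gdck_ge_exp[OF c _ _ n(2,1) True, of k] k by (simp add: X_def R_def C_def mult_ac)
  ultimately have "real (card ?B) / real (card (Gdck d c k n)) \<le> exp (X - q + 4 * R) / exp (X - C * R)"
    by (intro frac_le) auto
  also have "\<dots> = exp ((4 + C) * R - q)"
    unfolding exp_diff[symmetric] by (simp add: algebra_simps)
  also have "4 + C = 10 - ln c - ln ((1 - c) / 4)" by (simp add: C_def)
  finally show ?thesis by (simp add: R_def q_def mult_ac)
qed (simp add: Gdck_empty)

text \<open>For odd \<open>n * d\<close> there are no \<open>d\<close>-regular graphs. If
  \<open>d < k - 1\<close>, the factor \<open>d choose (k - 1)\<close> vanishes and the class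
  consists of all \<open>d\<close>-regular graphs, so the first estimate concerns
  \<open>d \<ge> k - 1\<close>.\<close>

theorem theorem4:
  fixes k :: nat and c :: real and d :: "nat \<Rightarrow> nat"
  assumes "k \<ge> 3" and "0 < c" and "c < 1"
    and "(\<lambda>n. real (d n) / real n) \<longlonglongrightarrow> 0"
    and "\<forall>\<^sub>F n in sequentially. d n \<ge> k - 1"
  shows "(\<exists>C. \<forall>\<^sub>F n in sequentially. even (n * d n) \<longrightarrow>
            \<bar>ln (real (card (Gdck (d n) c k n))) / ((real (d n) / 2) * real n * ln (real n))
               - (1 - c * ((real (d n) - 1) / (real (d n) + 1)))\<bar>
            \<le> C * (ln (real (d n)) / ln (real n)))
       \<and> (\<forall>d0::nat. \<forall>\<epsilon>::real. \<epsilon> > 0 \<longrightarrow>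
            (\<lambda>n. real (card {E \<in> Gdck d0 c k n. real (card (bad_nodes n d0 k E)) > \<epsilon> * real n})
                 / real (card (Gdck d0 c k n))) \<longlonglongrightarrow> 0)"
proof (intro conjI allI impI)
  have large: "\<forall>\<^sub>F n in sequentially. 64 / (1 - c) ^ 2 \<le> real n \<and> m \<le> n" for m
    using eventually_ge_at_top[of "nat \<lceil>64 / (1 - c) ^ 2\<rceil>"] eventually_ge_at_top[of m]
    by eventually_elim linarith
  have "\<forall>\<^sub>F n in sequentially. even (n * d n) \<longrightarrow>
            \<bar>ln (real (card (Gdck (d n) c k n))) / ((real (d n) / 2) * real n * ln (real n))
               - (1 - c * ((real (d n) - 1) / (real (d n) + 1)))\<bar>
            \<le> 2 * (6 - ln c - ln ((1 - c) / 4)) * (ln (real (d n)) / ln (real n))"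
    using assms(5) large[of 2]
    by eventually_elim (intro impI abs_ln_card_Gdck_le assms; simp)
  then show "\<exists>C. \<forall>\<^sub>F n in sequentially. even (n * d n) \<longrightarrow>
            \<bar>ln (real (card (Gdck (d n) c k n))) / ((real (d n) / 2) * real n * ln (real n))
               - (1 - c * ((real (d n) - 1) / (real (d n) + 1)))\<bar>
            \<le> C * (ln (real (d n)) / ln (real n))" by blast
  fix d0 :: nat and \<epsilon> :: real assume \<epsilon>: "\<epsilon> > 0"
  let ?r = "\<lambda>n. real (card {E \<in> Gdck d0 c k n. real (card (bad_nodes n d0 k E)) > \<epsilon> * real n})
                 / real (card (Gdck d0 c k n))"
  show "?r \<longlonglongrightarrow> 0"
  proof (cases "d0 < k - 1")
    case True
    have "bad_nodes n d0 k E = {}" if "E \<in> Gdck d0 c k n" for n E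
      using bad_nodes_empty[OF _ True] that by (simp add: Gdck_def)
    then have none: "{E \<in> Gdck d0 c k n. real (card (bad_nodes n d0 k E)) > \<epsilon> * real n} = {}" for n
      using \<epsilon> by (auto simp: not_less)
    show ?thesis unfolding none by simp
  next
    case False
    define K where "K = (10 - ln c - ln ((1 - c) / 4)) * real d0 * ln (real d0)"
    define \<eta> where "\<eta> = \<epsilon> / (2 * (real d0 + 1) ^ 2)"
    have "\<eta> > 0" using \<epsilon> by (simp add: \<eta>_def)
    show ?thesis
    proof (rule tendsto_sandwich)
      show "\<forall>\<^sub>F n in sequentially. 0 \<le> ?r n" by simp
      show "\<forall>\<^sub>F n in sequentially. ?r n \<le> exp (K * real n - \<eta> * real n * ln (real n))"
        using large[of 1] large[of "d0 ^ 4"] unfolding K_def \<eta>_def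
        by eventually_elim (rule bad_proportion_le; use assms False in simp)
      show "(\<lambda>n. exp (K * real n - \<eta> * real n * ln (real n))) \<longlonglongrightarrow> 0"
      proof (rule filterlim_compose[OF exp_at_bot])
        \<comment> \<open>The saving of order \<open>n * ln n\<close> outgrows the error linear in
          \<open>n\<close>, so the exponent tends to minus infinity.\<close>
        have "filterlim (\<lambda>n. real n * (- K + \<eta> * ln (real n))) at_top sequentially"
          using \<open>\<eta> > 0\<close>
          by (intro filterlim_at_top_mult_at_top filterlim_real_sequentially
              filterlim_tendsto_add_at_top[OF tendsto_const] filterlim_tendsto_pos_mult_at_top[OF tendsto_const]
              filterlim_compose[OF ln_at_top filterlim_real_sequentially])
        then show "filterlim (\<lambda>n. K * real n - \<eta> * real n * ln (real n)) at_bot sequentially"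
          by (simp add: filterlim_uminus_at_bot algebra_simps)
      qed
    qed simp
  qed
qed

end
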